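(* Let $\mathbb{H}=(\mathcal X,P,\{\mathcal Q_n\}_{n\in\mathbb N})$ consist of a finite set $\mathcal X$, a distribution $P\in\mathcal P(\mathcal X)$ and sets $\mathcal Q_n\subseteq\mathcal P(\mathcal X^n)$, and write $\mathcal Q=\mathcal Q_1$. Let $1<b\le\infty$ and suppose that Axioms 2, 3, 4 and 5 (stated in the context) are satisfied on $J=[1,b)$. Then for every $R>0$ with $R<R_b$, $$\mathrm{sc}_R(\mathbb H)=\sup_{s\in(1,b)}\Big\{\frac{s-1}{s}\big(R-D_s(P\|\mathcal Q)\big)\Big\}.$$
   Context: $\mathcal P(\mathcal X)$ is the set of probability mass functions (distributions) on the finite set $\mathcal X$; $P^{\times n}(x^n)=\prod_{i=1}^nP(x_i)$. $\log$ and $\exp$ are inverse to each other, in any fixed base. Hypothesis testing. For a test $T:\mathcal X^n\to[0,1]$ put $\alpha(T;P^{\times n})=\sum_{x^n}P^{\times n}(x^n)(1-T(x^n))$ and $\beta(T;\mathcal Q_n)=\sup_{Q\in\mathcal Q_n}\sum_{x^n}Q(x^n)T(x^n)$. Let $\hat\alpha(\mu;P^{\times n}\|\mathcal Q_n)=\min_T\{\alpha(T;P^{\times n}):\beta(T;\mathcal Q_n)\le\mu\}$. The strong converse exponent is, for $R>0$, $\mathrm{sc}_R(\mathbb H)=\limsup_{n\to\infty}-\frac1n\log\big(1-\hat\alpha(\exp(-nR);P^{\times n}\|\mathcal Q_n)\big)$. Rényi divergence. For $s\in(0,1)\cup(1,\infty)$, $g_s(P\|Q)=\sum_{x:P(x)>0}P(x)^sQ(x)^{1-s}$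 (equal to $+\infty$ if $s>1$ and $Q(x)=0<P(x)$ for some $x$), $D_s(P\|Q)=\frac{1}{s-1}\log g_s(P\|Q)$, and $D_1(P\|Q)=D(P\|Q)=\sum_xP(x)(\log P(x)-\log Q(x))$. For a set, $D_s(P\|\mathcal Q)=\inf_{Q\in\mathcal Q}D_s(P\|Q)$. Critical rate. $\phi(s)=(s-1)D_s(P\|\mathcal Q)$ and $R_b=\lim_{s\nearrow b}\big(s\phi'(s)-\phi(s)\big)\in(-\infty,+\infty]$. Permutations. $S_n$ acts on $\mathcal P(\mathcal X^n)$ by $(P^nW^n[\pi])(x_1,\dots,x_n)=P^n(x_{\pi(1)},\dots,x_{\pi(n)})$; $\mathcal P^{\rm sym}(\mathcal X^n)$ is the set of invariant distributions and $\mathcal Q_n^{\rm sym}=\mathcal Q_n\cap\mathcal P^{\rm sym}(\mathcal X^n)$. Axioms on an interval $J$ containing $1$: Axiom 2: $Q^{\times n}\in\mathcal Q_n$ for every $Q\in\mathcal Q$ and $n\in\mathbb N$. Axiom 3: $D_s(P^{\times n}\|\mathcal Q_n)\ge nD_s(P\|\mathcal Q)$ for all $s\in J$, $n\in\mathbb N$. Axiom 4: there are $U^n\in\mathcal P^{\rm sym}(\mathcal X^n)$, $n\in\mathbb N$, and a polynomial $v(n)$ such that for all $n$: $Q(x^n)\le v(n)U^n(x^n)$ for all $Q\in\mathcal Q_n^{\rm sym}$ and $x^n\in\mathcal X^n$; and $D_s(P^{\times n}\|U^n)\ge D_s(P^{\times n}\|\mathcal Q_n)$ for all $s\in J$. Moreover,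 $P^n\in\mathcal Q_n$ implies $\frac1{n!}\sum_{\pi\in S_n}P^nW^n[\pi]\in\mathcal Q_n^{\rm sym}$. Axiom 5: there is a compact convex set $\Theta$ in a finite-dimensional vector space and a $C^2$ map $\theta\mapsto Q_\theta$ with $\mathcal Q=\{Q_\theta:\theta\in\Theta\}$ such that: for all $s\in J$ the minimizer $\hat\theta^s=\arg\min_{\theta\in\Theta}D_s(P\|Q_\theta)$ is unique and lies in the relative interior of $\Theta$; the map $\theta\mapsto g_s(P\|Q_\theta)$ has negative definite Hessian at $\hat\theta^s$ for all $s\in J$ with $s<1$ and positive definite Hessian at $\hat\theta^s$ for all $s\in J$ with $s>1$; and $\theta\mapsto D_1(P\|Q_\theta)$ has positive definite Hessian at $\hat\theta^1$. *)

theory Defs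
  imports
    "HOL-Probability.Probability"
    "HOL-Combinatorics.Permutations"
    "HOL-Computational_Algebra.Polynomial"
begin

section \<open>Distributions on blocks\<close>

text \<open>
  An element of the n-th power of the alphabet is a list of length \<^term>\<open>n\<close> over a finite type, and a
  distribution on that power is a \<^typ>\<open>'x list pmf\<close> concentrated on those lists. All logarithms and
  exponentials are taken to a common base \<^term>\<open>a\<close>, which is an explicit parameter.
\<close>

definition blocks :: "nat \<Rightarrow> 'x list set" where
  "blocks n = {xs. length xs = n}"

definition block_dists :: "nat \<Rightarrow> 'x list pmf set" where
  "block_dists n = {Q. set_pmf Q \<subseteq> blocks n}"

text \<open>The i.i.d. distribution is the library's \<^const>\<open>replicate_pmf\<close>.\<close>

lemma pmf_replicate_pmf:
  assumes "length xs = n"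
  shows "pmf (replicate_pmf n P) xs = (\<Prod>i<n. pmf P (xs ! i))"
  using assms
proof (induction n arbitrary: xs)
  case 0
  then show ?case by simp
next
  case (Suc n)
  then obtain y ys where xs: "xs = y # ys" "length ys = n"
    by (cases xs) auto
  have "replicate_pmf (Suc n) P = map_pmf (\<lambda>(x, zs). x # zs) (pair_pmf P (replicate_pmf n P))"
    by (simp add: map_pmf_def pair_pmf_def bind_assoc_pmf bind_return_pmf)
  moreover have "pmf (map_pmf (\<lambda>(x, zs). x # zs) (pair_pmf P (replicate_pmf n P)))
      ((\<lambda>(x, zs). x # zs) (y, ys)) = pmf (pair_pmf P (replicate_pmf n P)) (y, ys)"
    by (rule pmf_map_inj') (auto simp: inj_def)
  ultimately have "pmf (replicate_pmf (Suc n) P) xs = pmf P y * pmf (replicate_pmf n P) ys"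
    by (simp add: xs(1) pmf_pair)
  moreover have "(\<Prod>i<Suc n. pmf P (xs ! i)) = pmf P y * (\<Prod>i<n. pmf P (ys ! i))"
    by (simp add: xs(1) prod.lessThan_Suc_shift del: prod.lessThan_Suc)
  ultimately show ?case
    using Suc.IH[OF xs(2)] by simp
qed

text \<open>
  The i-th entry of \<^term>\<open>permute_list \<pi> xs\<close> is \<^term>\<open>xs ! \<pi> i\<close>, so
  \<^term>\<open>\<lambda>xs. pmf Q (permute_list \<pi> xs)\<close> is the distribution \<^term>\<open>Q\<close> acted on by \<^term>\<open>\<pi>\<close>.
\<close>

definition sym_dists :: "nat \<Rightarrow> 'x list pmf set" where
  "sym_dists n = {Q \<in> block_dists n.
     \<forall>\<pi>. \<pi> permutes {..<n} \<longrightarrow> (\<forall>xs \<in> blocks n. pmf Q (permute_list \<pi> xs) = pmf Q xs)}"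

text \<open>The first set of a family, read as a set of distributions on the alphabet itself.\<close>

definition single_letter :: "(nat \<Rightarrow> 'x list pmf set) \<Rightarrow> 'x pmf set" where
  "single_letter \<Q> = {Q. map_pmf (\<lambda>x. [x]) Q \<in> \<Q> 1}"


section \<open>Hypothesis testing\<close>

definition type1_error :: "nat \<Rightarrow> 'x::finite list pmf \<Rightarrow> ('x list \<Rightarrow> real) \<Rightarrow> real" where
  "type1_error n P T = (\<Sum>xs\<in>blocks n. pmf P xs * (1 - T xs))"

definition type2_error :: "nat \<Rightarrow> 'x::finite list pmf set \<Rightarrow> ('x list \<Rightarrow> real) \<Rightarrow> real" where
  "type2_error n Qn T = (SUP Q\<in>Qn. \<Sum>xs\<in>blocks n. pmf Q xs * T xs)"

definition opt_type1_error :: "nat \<Rightarrow> real \<Rightarrow> 'x::finite list pmf \<Rightarrow> 'x list pmf set \<Rightarrow> real" where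
  "opt_type1_error n \<mu> P Qn =
     Inf {type1_error n P T | T. T \<in> blocks n \<rightarrow> {0..1} \<and> type2_error n Qn T \<le> \<mu>}"

definition strong_converse_exponent ::
    "real \<Rightarrow> 'x::finite pmf \<Rightarrow> (nat \<Rightarrow> 'x list pmf set) \<Rightarrow> real \<Rightarrow> ereal" where
  "strong_converse_exponent a P \<Q> R = limsup (\<lambda>n. ereal (- (1 / real n) *
     log a (1 - opt_type1_error n (a powr (- (real n * R))) (replicate_pmf n P) (\<Q> n))))"


section \<open>Renyi divergence\<close>

definition log_ereal :: "real \<Rightarrow> ereal \<Rightarrow> ereal" where
  "log_ereal a y = (if y = \<infinity> then \<infinity> else if y \<le> 0 then -\<infinity> else ereal (log a (real_of_ereal y)))"

text \<open>
  The sums below are meant for finitely supported \<^term>\<open>P\<close>, which covers all distributions on blocks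
  over a finite alphabet.
\<close>

definition renyi_sum :: "real \<Rightarrow> 'a pmf \<Rightarrow> 'a pmf \<Rightarrow> ereal" where
  "renyi_sum s P Q =
     (if s > 1 \<and> (\<exists>x. pmf P x > 0 \<and> pmf Q x = 0) then \<infinity>
      else ereal (\<Sum>x | pmf P x > 0. pmf P x powr s * pmf Q x powr (1 - s)))"

definition relative_entropy :: "real \<Rightarrow> 'a pmf \<Rightarrow> 'a pmf \<Rightarrow> ereal" where
  "relative_entropy a P Q =
     (if \<exists>x. pmf P x > 0 \<and> pmf Q x = 0 then \<infinity>
      else ereal (\<Sum>x | pmf P x > 0. pmf P x * (log a (pmf P x) - log a (pmf Q x))))"

definition renyi_div :: "real \<Rightarrow> real \<Rightarrow> 'a pmf \<Rightarrow> 'a pmf \<Rightarrow> ereal" where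
  "renyi_div a s P Q =
     (if s = 1 then relative_entropy a P Q
      else ereal (1 / (s - 1)) * log_ereal a (renyi_sum s P Q))"

definition renyi_div_set :: "real \<Rightarrow> real \<Rightarrow> 'a pmf \<Rightarrow> 'a pmf set \<Rightarrow> ereal" where
  "renyi_div_set a s P \<Q> = (INF Q\<in>\<Q>. renyi_div a s P Q)"

text \<open>
  The potential is only evaluated where the divergence is finite, so the conversion to a real number
  loses nothing.
\<close>

definition renyi_potential :: "real \<Rightarrow> 'a pmf \<Rightarrow> 'a pmf set \<Rightarrow> real \<Rightarrow> real" where
  "renyi_potential a P \<Q> s = real_of_ereal (ereal (s - 1) * renyi_div_set a s P \<Q>)"

definition critical_rate :: "real \<Rightarrow> 'a pmf \<Rightarrow> 'a pmf set \<Rightarrow> ereal \<Rightarrow> ereal" where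
  "critical_rate a P \<Q> b =
     Lim (if b = \<infinity> then at_top else at_left (real_of_ereal b))
       (\<lambda>s. ereal (s * deriv (renyi_potential a P \<Q>) s - renyi_potential a P \<Q> s))"


section \<open>Second order differentiability relative to a convex set\<close>

text \<open>
  A convex set may have empty interior in the ambient space. Derivatives are therefore taken within
  the set, and definiteness of a Hessian is tested on the directions of its affine hull. On these
  directions the first and second derivatives within the set are uniquely determined at points of the
  relative interior.
\<close>

definition hull_directions :: "'v::real_vector set \<Rightarrow> 'v set" where
  "hull_directions S = span {x - y | x y. x \<in> S \<and> y \<in> S}"

definition C2_on :: "'v::euclidean_space set \<Rightarrow> ('v \<Rightarrow> real) \<Rightarrow> bool" where
  "C2_on S f \<longleftrightarrow>
     (\<exists>(f' :: 'v \<Rightarrow> 'v \<Rightarrow>\<^sub>L real) (f'' :: 'v \<Rightarrow> 'v \<Rightarrow>\<^sub>L 'v \<Rightarrow>\<^sub>L real).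
        (\<forall>x\<in>S. (f has_derivative blinfun_apply (f' x)) (at x within S) \<and>
               (f' has_derivative blinfun_apply (f'' x)) (at x within S)) \<and>
        continuous_on S f'')"

text \<open>
  Having a Hessian at \<^term>\<open>z\<close> includes that the extended real valued function is finite on the points
  of \<^term>\<open>S\<close> near \<^term>\<open>z\<close>.
\<close>

definition has_hessian_within ::
    "('v::euclidean_space \<Rightarrow> ereal) \<Rightarrow> ('v \<Rightarrow> 'v \<Rightarrow>\<^sub>L real) \<Rightarrow> 'v \<Rightarrow> 'v set \<Rightarrow> bool" where
  "has_hessian_within F H z S \<longleftrightarrow>
     (\<exists>\<epsilon>>0. \<exists>(f :: 'v \<Rightarrow> real) (f' :: 'v \<Rightarrow> 'v \<Rightarrow>\<^sub>L real).
        (\<forall>y \<in> S \<inter> ball z \<epsilon>. F y = ereal (f y) \<and>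
                          (f has_derivative blinfun_apply (f' y)) (at y within S)) \<and>
        (f' has_derivative H) (at z within S))"

definition pos_def_hessian :: "('v::euclidean_space \<Rightarrow> ereal) \<Rightarrow> 'v \<Rightarrow> 'v set \<Rightarrow> bool" where
  "pos_def_hessian F z S \<longleftrightarrow>
     (\<exists>H. has_hessian_within F H z S \<and> (\<forall>u \<in> hull_directions S. u \<noteq> 0 \<longrightarrow> blinfun_apply (H u) u > 0))"

definition neg_def_hessian :: "('v::euclidean_space \<Rightarrow> ereal) \<Rightarrow> 'v \<Rightarrow> 'v set \<Rightarrow> bool" where
  "neg_def_hessian F z S \<longleftrightarrow>
     (\<exists>H. has_hessian_within F H z S \<and> (\<forall>u \<in> hull_directions S. u \<noteq> 0 \<longrightarrow> blinfun_apply (H u) u < 0))"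


section \<open>Conditions on the family of alternatives\<close>

definition iid_closed :: "(nat \<Rightarrow> 'x list pmf set) \<Rightarrow> bool" where
  "iid_closed \<Q> \<longleftrightarrow> (\<forall>n\<ge>1. \<forall>Q \<in> single_letter \<Q>. replicate_pmf n Q \<in> \<Q> n)"

definition renyi_superadditive ::
    "real \<Rightarrow> real set \<Rightarrow> 'x pmf \<Rightarrow> (nat \<Rightarrow> 'x list pmf set) \<Rightarrow> bool" where
  "renyi_superadditive a J P \<Q> \<longleftrightarrow>
     (\<forall>s\<in>J. \<forall>n\<ge>1. renyi_div_set a s (replicate_pmf n P) (\<Q> n)
                       \<ge> ereal (real n) * renyi_div_set a s P (single_letter \<Q>))"

definition universally_dominated ::
    "real \<Rightarrow> real set \<Rightarrow> 'x pmf \<Rightarrow> (nat \<Rightarrow> 'x list pmf set) \<Rightarrow> bool" where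
  "universally_dominated a J P \<Q> \<longleftrightarrow>
     (\<exists>(U :: nat \<Rightarrow> 'x list pmf) (v :: real poly). \<forall>n\<ge>1.
        U n \<in> sym_dists n \<and>
        (\<forall>Q \<in> \<Q> n \<inter> sym_dists n. \<forall>xs \<in> blocks n. pmf Q xs \<le> poly v (real n) * pmf (U n) xs) \<and>
        (\<forall>s\<in>J. renyi_div a s (replicate_pmf n P) (U n)
                  \<ge> renyi_div_set a s (replicate_pmf n P) (\<Q> n))) \<and>
     (\<forall>n\<ge>1. \<forall>Q \<in> \<Q> n. \<exists>Q' \<in> \<Q> n \<inter> sym_dists n. \<forall>xs \<in> blocks n.
        pmf Q' xs = 1 / fact n * (\<Sum>\<pi> | \<pi> permutes {..<n}. pmf Q (permute_list \<pi> xs)))"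

definition regularly_parametrized ::
    "real \<Rightarrow> real set \<Rightarrow> 'x pmf \<Rightarrow> 'x pmf set \<Rightarrow> 'v::euclidean_space set \<Rightarrow> ('v \<Rightarrow> 'x pmf) \<Rightarrow> bool" where
  "regularly_parametrized a J P \<Q> \<Theta> q \<longleftrightarrow>
     compact \<Theta> \<and> convex \<Theta> \<and> (\<forall>x. C2_on \<Theta> (\<lambda>\<theta>. pmf (q \<theta>) x)) \<and> \<Q> = q ` \<Theta> \<and>
     (\<forall>s\<in>J. \<exists>\<theta>\<^sub>s \<in> rel_interior \<Theta>.
        (\<forall>\<theta>. is_arg_min (\<lambda>\<theta>. renyi_div a s P (q \<theta>)) (\<lambda>\<theta>. \<theta> \<in> \<Theta>) \<theta> \<longleftrightarrow> \<theta> = \<theta>\<^sub>s) \<and>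
        (s < 1 \<longrightarrow> neg_def_hessian (\<lambda>\<theta>. renyi_sum s P (q \<theta>)) \<theta>\<^sub>s \<Theta>) \<and>
        (s > 1 \<longrightarrow> pos_def_hessian (\<lambda>\<theta>. renyi_sum s P (q \<theta>)) \<theta>\<^sub>s \<Theta>) \<and>
        (s = 1 \<longrightarrow> pos_def_hessian (\<lambda>\<theta>. renyi_div a 1 P (q \<theta>)) \<theta>\<^sub>s \<Theta>))"

end

theory Submission
  imports Defs
begin

text \<open>
  The Hoelder inequality against the i.i.d. power of a single-letter minimizer bounds the power of every
  admissible test, which gives one direction.

  For the other direction, let g be the sum of \<open>P powr s * U powr (1 - s)\<close> over blocks of length n, where P is
  i.i.d. and U is the dominating distribution. Domination and superadditivity give
  \<open>(1/n) log g \<longlonglongrightarrow> \<phi> s\<close> on (1, b), so the potential \<open>\<phi>\<close> is convex. It also lies below the smooth function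
  belonging to a minimizer at s and touches it there, hence it is differentiable. As in the
  Gaertner-Ellis theorem, the distribution tilted by s concentrates on the blocks whose
  log likelihood ratio is close to \<open>n \<phi>' s\<close>. Testing for these blocks is permutation invariant, so it
  suffices to control its error under U, and it achieves the exponent \<open>(s - 1) \<phi>' s - \<phi> s\<close> whenever
  \<open>R \<le> s \<phi>' s - \<phi> s\<close>. Since the objective has derivative \<open>(R - (s \<phi>' s - \<phi> s)) / s\<^sup>2\<close>, equality holds
  in this condition at an interior maximizer, and there the two exponents agree. If the maximum is
  attained only as s tends to 1, both sides are 0.
\<close>

section \<open>Finite sums of powers\<close>

text \<open>Hoelder's inequality for the conjugate exponents \<open>1 / t\<close> and
  \<open>1 / (1 - t)\<close>. After division by the totals, Young's inequality holds term by term
  and its right-hand sides add up to 1.\<close>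

lemma sum_powr_mult_powr_le:
  fixes x y :: "'a \<Rightarrow> real"
  assumes fin: "finite A" and x: "\<And>i. i \<in> A \<Longrightarrow> 0 \<le> x i" and y: "\<And>i. i \<in> A \<Longrightarrow> 0 \<le> y i"
    and t: "0 < t" "t < 1"
  shows "(\<Sum>i\<in>A. x i powr t * y i powr (1 - t)) \<le> sum x A powr t * sum y A powr (1 - t)"
proof -
  define X where "X = sum x A"
  define Y where "Y = sum y A"
  have nonneg: "X \<ge> 0" "Y \<ge> 0"
    unfolding X_def Y_def by (auto intro: sum_nonneg x y)
  show ?thesis
  proof (cases "X = 0 \<or> Y = 0")
    case True
    then have "x i powr t * y i powr (1 - t) = 0" if "i \<in> A" for i
      using that sum_nonneg_eq_0_iff[OF fin x] sum_nonneg_eq_0_iff[OF fin y]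
      by (auto simp: X_def Y_def)
    then have "(\<Sum>i\<in>A. x i powr t * y i powr (1 - t)) = 0" by (intro sum.neutral) blast
    then show ?thesis by simp
  next
    case False
    then have pos: "X > 0" "Y > 0" using nonneg by auto
    have "x i powr t * y i powr (1 - t)
        \<le> X powr t * Y powr (1 - t) * (t * (x i / X) + (1 - t) * (y i / Y))" if "i \<in> A" for i
    proof (cases "x i = 0 \<or> y i = 0")
      case True
      then show ?thesis using x[OF that] y[OF that] pos t by auto
    next
      case False
      then have "x i > 0" "y i > 0" using x[OF that] y[OF that] by auto
      then have "(x i / X) powr t * (y i / Y) powr (1 - t) \<le> t * (x i / X) + (1 - t) * (y i / Y)"
        using pos t by (intro Youngs_inequality_0) auto
      then have "X powr t * Y powr (1 - t) * ((x i / X) powr t * (y i / Y) powr (1 - t))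
          \<le> X powr t * Y powr (1 - t) * (t * (x i / X) + (1 - t) * (y i / Y))"
        using pos by (intro mult_left_mono) auto
      moreover have "X powr t * Y powr (1 - t) * ((x i / X) powr t * (y i / Y) powr (1 - t))
          = x i powr t * y i powr (1 - t)"
        using pos by (simp add: powr_divide)
      ultimately show ?thesis by simp
    qed
    then have "(\<Sum>i\<in>A. x i powr t * y i powr (1 - t))
        \<le> (\<Sum>i\<in>A. X powr t * Y powr (1 - t) * (t * (x i / X) + (1 - t) * (y i / Y)))"
      by (rule sum_mono)
    also have "\<dots> = X powr t * Y powr (1 - t) * (t * (X / X) + (1 - t) * (Y / Y))"
      by (simp add: X_def Y_def sum_distrib_left[symmetric] sum.distrib sum_divide_distrib[symmetric])
    finally show ?thesis using pos by (simp add: X_def Y_def)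
  qed
qed

text \<open>A real-valued Renyi sum for arbitrary weights. Since \<open>0 powr r = 0\<close>, points
  with \<open>u x = 0\<close> contribute nothing at any order, so for \<open>s > 1\<close> agreement
  with \<open>renyi_sum\<close> requires absolute continuity.\<close>

definition chernoff_sum :: "'a set \<Rightarrow> ('a \<Rightarrow> real) \<Rightarrow> ('a \<Rightarrow> real) \<Rightarrow> real \<Rightarrow> real" where
  "chernoff_sum A p u s = (\<Sum>x\<in>A. p x powr s * u x powr (1 - s))"

lemma chernoff_sum_nonneg: "0 \<le> chernoff_sum A p u s"
  by (simp add: chernoff_sum_def sum_nonneg)

lemma chernoff_sum_pos:
  assumes "finite A" "x \<in> A" "0 < p x" "0 < u x"
  shows "0 < chernoff_sum A p u s"
  unfolding chernoff_sum_def by (rule sum_pos2[OF assms(1,2)]) (use assms in auto)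

text \<open>Each summand at the intermediate order is the weighted geometric mean of the summands at
  \<open>s\<close> and \<open>s'\<close>, so Hoelder's inequality applies.\<close>

lemma chernoff_sum_log_convex:
  assumes "finite A" and t: "0 < t" "t < 1"
  shows "chernoff_sum A p u ((1 - t) * s + t * s')
    \<le> chernoff_sum A p u s powr (1 - t) * chernoff_sum A p u s' powr t"
proof -
  have "p x powr ((1 - t) * s + t * s') * u x powr (1 - ((1 - t) * s + t * s'))
      = (p x powr s * u x powr (1 - s)) powr (1 - t) * (p x powr s' * u x powr (1 - s')) powr t" for x
  proof -
    have "(1 - t) * s + t * s' = s * (1 - t) + s' * t"
        "1 - ((1 - t) * s + t * s') = (1 - s) * (1 - t) + (1 - s') * t"
      by (simp_all add: algebra_simps)
    then show ?thesis
      by (simp only: powr_mult powr_powr powr_add mult_ac)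
  qed
  then show ?thesis
    using sum_powr_mult_powr_le[OF assms(1), of "\<lambda>x. p x powr s * u x powr (1 - s)"
        "\<lambda>x. p x powr s' * u x powr (1 - s')" "1 - t"] t
    by (simp add: chernoff_sum_def)
qed

lemma chernoff_sum_has_derivative:
  assumes p: "\<And>x. x \<in> A \<Longrightarrow> 0 \<le> p x" and u: "\<And>x. x \<in> A \<Longrightarrow> 0 \<le> u x"
  shows "(chernoff_sum A p u has_real_derivative
    (\<Sum>x\<in>A. p x powr s * u x powr (1 - s) * (ln (p x) - ln (u x)))) (at s)"
  unfolding chernoff_sum_def [abs_def]
proof (rule DERIV_sum)
  fix x assume x: "x \<in> A"
  show "((\<lambda>s. p x powr s * u x powr (1 - s)) has_real_derivative
      p x powr s * u x powr (1 - s) * (ln (p x) - ln (u x))) (at s)"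
  proof (cases "p x = 0 \<or> u x = 0")
    \<comment> \<open>The term is constantly 0 in the order, and its factor 0 absorbs the value of
      \<open>ln 0\<close> in the derivative.\<close>
    case True
    then show ?thesis by auto
  next
    case False
    then have "0 < p x" "0 < u x" using p[OF x] u[OF x] by auto
    then show ?thesis
      by (auto intro!: derivative_eq_intros simp: algebra_simps)
  qed
qed

text \<open>Hoelder's inequality with exponents \<open>s\<close> and \<open>s / (s - 1)\<close>; it
  bounds the power of a test \<open>T\<close> by its error under \<open>u\<close>.\<close>

lemma weighted_sum_le_chernoff_sum:
  assumes fin: "finite A" and p: "\<And>x. x \<in> A \<Longrightarrow> 0 \<le> p x" and u: "\<And>x. x \<in> A \<Longrightarrow> 0 \<le> u x"
    and ac: "\<And>x. x \<in> A \<Longrightarrow> u x = 0 \<Longrightarrow> p x = 0"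
    and T: "\<And>x. x \<in> A \<Longrightarrow> T x \<in> {0..1}" and s: "1 < s"
  shows "(\<Sum>x\<in>A. p x * T x) \<le> chernoff_sum A p u s powr (1 / s) * (\<Sum>x\<in>A. u x * T x) powr (1 - 1 / s)"
proof -
  \<comment> \<open>The powers of \<open>u x\<close> cancel and those of \<open>T x\<close> add up
    to 1. Absolute continuity gives \<open>u x > 0\<close> wherever the left side is
    nonzero.\<close>
  have "p x * T x = (p x powr s * u x powr (1 - s) * T x) powr (1 / s) * (u x * T x) powr (1 - 1 / s)"
    if x: "x \<in> A" for x
  proof (cases "p x = 0 \<or> T x = 0")
    case False
    then have pos: "p x > 0" "u x > 0" "T x > 0"
      using p[OF x] u[OF x] ac[OF x] T[OF x] by (simp, metis less_le, simp)
    have "(p x powr s * u x powr (1 - s) * T x) powr (1 / s) * (u x * T x) powr (1 - 1 / s)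
        = p x powr (s * (1 / s)) * u x powr ((1 - s) * (1 / s) + (1 - 1 / s)) * T x powr (1 / s + (1 - 1 / s))"
      by (simp only: powr_mult powr_powr powr_add mult_ac)
    also have "(1 - s) * (1 / s) + (1 - 1 / s) = 0" using s by (simp add: field_simps)
    finally show ?thesis using s pos by simp
  qed (use s in auto)
  then have "(\<Sum>x\<in>A. p x * T x)
      = (\<Sum>x\<in>A. (p x powr s * u x powr (1 - s) * T x) powr (1 / s) * (u x * T x) powr (1 - 1 / s))"
    by (rule sum.cong[OF refl])
  also have "\<dots> \<le> (\<Sum>x\<in>A. p x powr s * u x powr (1 - s) * T x) powr (1 / s) * (\<Sum>x\<in>A. u x * T x) powr (1 - 1 / s)"
    by (rule sum_powr_mult_powr_le) (use fin p u T s in auto)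
  also have "\<dots> \<le> chernoff_sum A p u s powr (1 / s) * (\<Sum>x\<in>A. u x * T x) powr (1 - 1 / s)"
    unfolding chernoff_sum_def
    by (intro mult_right_mono powr_mono2 sum_mono sum_nonneg mult_left_le) (use p u T s in auto)
  finally show ?thesis .
qed

text \<open>Outside the window E the tilted weights are controlled by changing the exponent s by t, inside it
  they are comparable with p and with u.\<close>

lemma likelihood_window:
  fixes p u :: "'a \<Rightarrow> real"
  defines "E \<equiv> \<lambda>l r. {x. l * u x \<le> p x \<and> p x \<le> r * u x}"
  assumes fin: "finite A" and p: "\<And>x. x \<in> A \<Longrightarrow> 0 \<le> p x" and u: "\<And>x. x \<in> A \<Longrightarrow> 0 \<le> u x"
    and ac: "\<And>x. x \<in> A \<Longrightarrow> u x = 0 \<Longrightarrow> p x = 0"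
    and l: "0 < l" and r: "0 < r" and s: "1 < s" and t: "0 < t"
  shows "chernoff_sum A p u s - r powr (- t) * chernoff_sum A p u (s + t)
      - l powr t * chernoff_sum A p u (s - t) \<le> r powr (s - 1) * sum p (A \<inter> E l r)" (is ?mass)
    and "sum u (A \<inter> E l r) \<le> l powr (- s) * chernoff_sum A p u s" (is ?null)
proof -
  define w where "w s x = p x powr s * u x powr (1 - s)" for s x
  \<comment> \<open>The tilted weight as a power of the likelihood ratio, relative to
    \<open>u\<close> or to \<open>p\<close>. The first form serves the tails and the comparison with
    \<open>u\<close>, the second the comparison with \<open>p\<close>.\<close>
  have w_pos: "w s x = u x * (p x / u x) powr s" "w s x = p x * (p x / u x) powr (s - 1)"
    if "0 < p x" "0 < u x" for s x
    using that by (simp_all add: w_def powr_diff powr_divide)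
  have w0: "w s x = 0" if "p x = 0" for s x using that by (simp add: w_def)
  have w_nonneg: "0 \<le> w s x" for s x by (simp add: w_def)
  have pos_if: "0 < p x" "0 < u x" if "x \<in> A" "p x \<noteq> 0" for x
    using p[OF that(1)] u[OF that(1)] ac[OF that(1)] that(2) by (simp, metis less_le)
  have upper: "w s x \<le> r powr (- t) * w (s + t) x" if x: "x \<in> A" "r * u x < p x" for x
  proof -
    have "p x \<noteq> 0" using x u[of x] r mult_nonneg_nonneg[of r "u x"] by linarith
    then have pos: "0 < p x" "0 < u x" using pos_if[OF x(1)] by auto
    then have "r powr t \<le> (p x / u x) powr t"
      using x r t by (intro powr_mono2) (auto simp: pos_le_divide_eq)
    then have "r powr t * w s x \<le> (p x / u x) powr t * w s x"
      by (intro mult_right_mono w_nonneg)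
    also have "\<dots> = w (s + t) x" using pos by (simp add: w_pos(1) powr_add)
    finally show ?thesis using r by (simp add: powr_minus field_simps)
  qed
  have lower: "w s x \<le> l powr t * w (s - t) x" if x: "x \<in> A" "p x < l * u x" for x
  proof (cases "p x = 0")
    case True then show ?thesis by (simp add: w0)
  next
    case False
    then have pos: "0 < p x" "0 < u x" using pos_if[OF x(1)] by auto
    then have "(p x / u x) powr t \<le> l powr t"
      using x l t by (intro powr_mono2) (auto simp: pos_divide_le_eq)
    then have "(p x / u x) powr t * w (s - t) x \<le> l powr t * w (s - t) x"
      by (intro mult_right_mono w_nonneg)
    moreover have "(p x / u x) powr t * w (s - t) x = w s x" using pos by (simp add: w_pos(1) powr_diff)
    ultimately show ?thesis by simp
  qed
  have inside: "w s x \<le> r powr (s - 1) * p x" "u x \<le> l powr (- s) * w s x"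
    if x: "x \<in> A" "x \<in> E l r" for x
  proof -
    have ratio: "l * u x \<le> p x" "p x \<le> r * u x" using x by (auto simp: E_def)
    show "w s x \<le> r powr (s - 1) * p x" "u x \<le> l powr (- s) * w s x"
    proof (atomize (full), cases "p x = 0")
      case True
      \<comment> \<open>As \<open>l > 0\<close>, the lower edge of the window forces
        \<open>u x = 0\<close> too.\<close>
      then have "u x = 0" using ratio l u[OF x(1)] by (simp add: mult_le_0_iff)
      then show "w s x \<le> r powr (s - 1) * p x \<and> u x \<le> l powr (- s) * w s x"
        using True by (simp add: w0)
    next
      case False
      then have pos: "0 < p x" "0 < u x" using pos_if[OF x(1)] by auto
      have "(p x / u x) powr (s - 1) \<le> r powr (s - 1)" "l powr s \<le> (p x / u x) powr s"
        using ratio pos l s by (auto intro!: powr_mono2 simp: pos_divide_le_eq pos_le_divide_eq)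
      then have "p x * (p x / u x) powr (s - 1) \<le> p x * r powr (s - 1)"
          "u x * l powr s \<le> u x * (p x / u x) powr s"
        using pos by (auto intro: mult_left_mono)
      then have "w s x \<le> r powr (s - 1) * p x" "l powr s * u x \<le> w s x"
        by (simp only: w_pos(2)[OF pos] mult.commute, simp only: w_pos(1)[OF pos] mult.commute)
      then show "w s x \<le> r powr (s - 1) * p x \<and> u x \<le> l powr (- s) * w s x"
        using l by (simp add: powr_minus field_simps)
    qed
  qed
  have chernoff: "chernoff_sum A p u s = sum (w s) A" for s by (simp add: chernoff_sum_def w_def)
  have "sum (w s) (A \<inter> E l r) \<le> r powr (s - 1) * sum p (A \<inter> E l r)"
    unfolding sum_distrib_left by (rule sum_mono) (use inside in auto)
  moreover have "sum (w s) A
      \<le> (\<Sum>x\<in>A. (if x \<in> E l r then w s x else 0) + r powr (- t) * w (s + t) x + l powr t * w (s - t) x)"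
  proof (rule sum_mono)
    fix x assume x: "x \<in> A"
    have nonneg: "0 \<le> r powr (- t) * w (s + t) x" "0 \<le> l powr t * w (s - t) x" by (simp_all add: w_nonneg)
    consider "x \<in> E l r" | "x \<notin> E l r" "r * u x < p x" | "x \<notin> E l r" "p x < l * u x"
      unfolding E_def mem_Collect_eq by (meson not_le)
    then show "w s x \<le> (if x \<in> E l r then w s x else 0) + r powr (- t) * w (s + t) x + l powr t * w (s - t) x"
    proof cases
      case 1 then show ?thesis using nonneg by simp
    next
      case 2 then show ?thesis using nonneg upper[OF x] by simp
    next
      case 3 then show ?thesis using nonneg lower[OF x] by simp
    qed
  qed
  moreover have "\<dots> = sum (w s) (A \<inter> E l r) + r powr (- t) * sum (w (s + t)) A + l powr t * sum (w (s - t)) A"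
    by (simp add: sum.distrib sum.inter_restrict[OF fin] sum_distrib_left)
  ultimately show ?mass unfolding chernoff by linarith
  have "sum u (A \<inter> E l r) \<le> (\<Sum>x\<in>A \<inter> E l r. l powr (- s) * w s x)"
    by (rule sum_mono) (use inside in auto)
  also have "\<dots> \<le> (\<Sum>x\<in>A. l powr (- s) * w s x)"
    by (rule sum_mono2) (use fin w_nonneg in auto)
  finally show ?null by (simp add: chernoff sum_distrib_left)
qed

section \<open>Polynomial factors against exponential decay\<close>

lemma poly_mult_powr_tendsto_0:
  fixes v :: "real poly"
  assumes "1 < a" "0 < d"
  shows "(\<lambda>n. poly v (real n) * a powr (- (real n * d))) \<longlonglongrightarrow> 0"
proof -
  have c: "0 < d * ln a" using assms by simp
  have lim: "(\<lambda>n. (real n * (d * ln a)) ^ i / exp (real n * (d * ln a))) \<longlonglongrightarrow> 0" for i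
    by (rule filterlim_compose[OF tendsto_power_div_exp_0])
      (use c in \<open>auto intro!: filterlim_real_sequentially filterlim_at_top_mult_tendsto_pos[OF tendsto_const]\<close>)
  \<comment> \<open>With \<open>z = real n * (d * ln a)\<close> the decay factor is
    \<open>exp (- z)\<close>, and rescaling the coefficients turns each monomial into a multiple of
    \<open>z ^ i / exp z\<close>.\<close>
  have "(\<lambda>n. \<Sum>i\<le>degree v. coeff v i / (d * ln a) ^ i * ((real n * (d * ln a)) ^ i / exp (real n * (d * ln a)))) \<longlonglongrightarrow> 0"
    by (rule tendsto_null_sum, rule tendsto_mult_right_zero, rule lim)
  moreover have "(\<Sum>i\<le>degree v. coeff v i / (d * ln a) ^ i * ((real n * (d * ln a)) ^ i / exp (real n * (d * ln a))))
      = poly v (real n) * a powr (- (real n * d))" for n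
  proof -
    have "a powr (- (real n * d)) = 1 / exp (real n * (d * ln a))"
      using assms by (simp add: powr_def exp_minus field_simps)
    moreover have "coeff v i / (d * ln a) ^ i * (real n * (d * ln a)) ^ i = coeff v i * real n ^ i" for i
      unfolding power_mult_distrib using c by (cases "i = 0") auto
    ultimately show ?thesis
      by (simp add: poly_altdef sum_divide_distrib)
  qed
  ultimately show ?thesis by simp
qed

text \<open>The exponent \<open>k\<close> is real, so the limit is applied to the
  \<open>k\<close>-th root of the claim, with rate \<open>d / k\<close>, and the result is raised to
  the power \<open>k\<close>.\<close>

lemma eventually_poly_powr_le:
  fixes v :: "real poly"
  assumes "1 < a" "0 < d" "0 < k" "0 < e" and "\<forall>\<^sub>F n in sequentially. 0 < poly v (real n)"
  shows "\<forall>\<^sub>F n in sequentially. poly v (real n) powr k * a powr (- (real n * d)) \<le> e"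
proof -
  have "\<forall>\<^sub>F n in sequentially. poly v (real n) * a powr (- (real n * (d / k))) < e powr (1 / k)"
    using poly_mult_powr_tendsto_0[OF assms(1), of "d / k"] assms by (intro order_tendstoD) auto
  then show ?thesis using assms(5)
  proof eventually_elim
    case (elim n)
    have "(poly v (real n) * a powr (- (real n * (d / k)))) powr k \<le> (e powr (1 / k)) powr k"
      by (rule powr_mono2) (use elim assms in auto)
    then show ?case using assms by (simp add: powr_mult powr_powr)
  qed
qed

section \<open>Divergences and averages on blocks\<close>

text \<open>Absolute continuity excludes the infinite value, and enlarging the support of
  \<open>P\<close> to \<open>A\<close> adds only zero terms.\<close>

lemma renyi_sum_eq_chernoff_sum:
  assumes "finite A" "set_pmf P \<subseteq> A" "set_pmf P \<subseteq> set_pmf Q"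
  shows "renyi_sum s P Q = ereal (chernoff_sum A (pmf P) (pmf Q) s)"
proof -
  have "\<not> (\<exists>x. 0 < pmf P x \<and> pmf Q x = 0)"
    using assms(3) by (auto simp: set_pmf_iff subset_iff)
  moreover have "(\<Sum>x | 0 < pmf P x. pmf P x powr s * pmf Q x powr (1 - s)) = chernoff_sum A (pmf P) (pmf Q) s"
    unfolding chernoff_sum_def
  proof (rule sum.mono_neutral_left)
    show "{x. 0 < pmf P x} \<subseteq> A" using assms(2) by (auto simp: set_pmf_iff subset_iff)
    show "\<forall>x\<in>A - {x. 0 < pmf P x}. pmf P x powr s * pmf Q x powr (1 - s) = 0"
      by (auto simp: not_less)
  qed (rule assms(1))
  ultimately show ?thesis by (simp add: renyi_sum_def)
qed

lemma chernoff_sum_pmf_pos: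
  assumes "finite A" "set_pmf P \<subseteq> A" "set_pmf P \<subseteq> set_pmf Q"
  shows "0 < chernoff_sum A (pmf P) (pmf Q) s"
proof -
  obtain x where "x \<in> set_pmf P" using set_pmf_not_empty[of P] by blast
  then show ?thesis using assms by (intro chernoff_sum_pos[of A x]) (auto intro: pmf_positive)
qed

lemma renyi_div_eq_log_chernoff_sum:
  assumes "finite A" "set_pmf P \<subseteq> A" "set_pmf P \<subseteq> set_pmf Q" "1 < s"
  shows "renyi_div a s P Q = ereal (log a (chernoff_sum A (pmf P) (pmf Q) s) / (s - 1))"
  using chernoff_sum_pmf_pos[OF assms(1-3), of s] assms
  by (simp add: renyi_div_def log_ereal_def renyi_sum_eq_chernoff_sum[OF assms(1-3)])

section \<open>Sums over blocks and i.i.d. distributions\<close>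

lemma finite_blocks [simp]: "finite (blocks n :: 'x::finite list set)"
  unfolding blocks_def using finite_lists_length_eq[of "UNIV :: 'x set" n] by simp

lemma blocks_Suc: "blocks (Suc n) = (\<lambda>(x, xs). x # xs) ` (UNIV \<times> blocks n)"
  by (auto simp: blocks_def length_Suc_conv image_iff)

lemma sum_blocks_prod:
  fixes f :: "'x::finite \<Rightarrow> real"
  shows "(\<Sum>xs\<in>blocks n. \<Prod>i<n. f (xs ! i)) = (\<Sum>x\<in>UNIV. f x) ^ n"
proof (induction n)
  case 0
  have "blocks 0 = {[] :: 'x list}" by (auto simp: blocks_def)
  then show ?case by simp
next
  case (Suc n)
  have "(\<Sum>xs\<in>blocks (Suc n). \<Prod>i<Suc n. f (xs ! i))
      = (\<Sum>(x, xs)\<in>UNIV \<times> blocks n. \<Prod>i<Suc n. f ((x # xs) ! i))"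
    unfolding blocks_Suc by (subst sum.reindex) (auto simp: inj_on_def case_prod_unfold)
  also have "\<dots> = (\<Sum>x\<in>UNIV. \<Sum>xs\<in>blocks n. f x * (\<Prod>i<n. f (xs ! i)))"
    unfolding sum.cartesian_product
    by (simp add: prod.lessThan_Suc_shift del: prod.lessThan_Suc)
  finally show ?case by (simp add: Suc.IH sum_distrib_left[symmetric] sum_distrib_right[symmetric])
qed

text \<open>The summand is a product over positions, so the sum factorizes; in logarithms this is
  additivity of the Renyi divergence.\<close>

lemma chernoff_sum_replicate_pmf:
  fixes P Q :: "'x::finite pmf"
  shows "chernoff_sum (blocks n) (pmf (replicate_pmf n P)) (pmf (replicate_pmf n Q)) s
    = chernoff_sum UNIV (pmf P) (pmf Q) s ^ n"
proof -
  have "chernoff_sum (blocks n) (pmf (replicate_pmf n P)) (pmf (replicate_pmf n Q)) s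
      = (\<Sum>xs\<in>blocks n. \<Prod>i<n. pmf P (xs ! i) powr s * pmf Q (xs ! i) powr (1 - s))"
    unfolding chernoff_sum_def
    by (rule sum.cong) (auto simp: blocks_def pmf_replicate_pmf prod_powr_distrib prod.distrib)
  then show ?thesis
    unfolding sum_blocks_prod[of "\<lambda>x. pmf P x powr s * pmf Q x powr (1 - s)"] by (simp add: chernoff_sum_def)
qed

lemma set_replicate_pmf_subset_blocks: "set_pmf (replicate_pmf n P) \<subseteq> blocks n"
  by (auto simp: set_replicate_pmf blocks_def)

lemma set_replicate_pmf_mono:
  "set_pmf P \<subseteq> set_pmf Q \<Longrightarrow> set_pmf (replicate_pmf n P) \<subseteq> set_pmf (replicate_pmf n Q)"
  by (auto simp: set_replicate_pmf)

lemma replicate_pmf_in_block_dists: "replicate_pmf n P \<in> block_dists n"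
  by (simp add: block_dists_def set_replicate_pmf_subset_blocks)

lemma replicate_pmf_in_sym_dists: "replicate_pmf n P \<in> sym_dists n"
  unfolding sym_dists_def
proof (intro CollectI conjI allI impI ballI)
  fix \<pi> and xs :: "'a list"
  assume \<pi>: "\<pi> permutes {..<n}" and xs: "xs \<in> blocks n"
  have len: "length xs = n" using xs by (simp add: blocks_def)
  have "pmf (replicate_pmf n P) (permute_list \<pi> xs) = (\<Prod>i<n. pmf P (xs ! \<pi> i))"
    using len \<pi> by (simp add: pmf_replicate_pmf permute_list_nth)
  also have "\<dots> = (\<Prod>i<n. pmf P (xs ! i))"
    using prod.permute[OF \<pi>, of "\<lambda>i. pmf P (xs ! i)"] by (simp add: o_def)
  finally show "pmf (replicate_pmf n P) (permute_list \<pi> xs) = pmf (replicate_pmf n P) xs"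
    using len by (simp add: pmf_replicate_pmf)
qed (rule replicate_pmf_in_block_dists)

lemma sum_pmf_blocks: "Q \<in> block_dists n \<Longrightarrow> (\<Sum>xs\<in>blocks n. pmf Q xs) = 1"
  for Q :: "'x::finite list pmf"
  by (auto intro: sum_pmf_eq_1 simp: block_dists_def)

lemma sum_pmf_blocks_test_le_1:
  fixes Q :: "'x::finite list pmf"
  assumes "Q \<in> block_dists n" "T \<in> blocks n \<rightarrow> {0..1}"
  shows "(\<Sum>xs\<in>blocks n. pmf Q xs * T xs) \<le> 1"
proof -
  have "(\<Sum>xs\<in>blocks n. pmf Q xs * T xs) \<le> (\<Sum>xs\<in>blocks n. pmf Q xs)"
    by (intro sum_mono mult_left_le) (use assms(2) in auto)
  then show ?thesis using sum_pmf_blocks[OF assms(1)] by simp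
qed

section \<open>Permutations and symmetrized alternatives\<close>

lemma bij_betw_permute_list_blocks:
  assumes "\<pi> permutes {..<n}"
  shows "bij_betw (permute_list \<pi>) (blocks n) (blocks n)"
proof (rule bij_betwI[where g = "permute_list (inv \<pi>)"])
  have inv: "inv \<pi> permutes {..<n}" by (rule permutes_inv[OF assms])
  show "permute_list (inv \<pi>) (permute_list \<pi> xs) = xs" if "xs \<in> blocks n" for xs
    using that inv permute_list_compose[of "inv \<pi>" xs \<pi>] permutes_inv_o(1)[OF assms]
    by (simp add: blocks_def)
  show "permute_list \<pi> (permute_list (inv \<pi>) xs) = xs" if "xs \<in> blocks n" for xs
    using that assms permute_list_compose[of \<pi> xs "inv \<pi>"] permutes_inv_o(2)[OF assms]
    by (simp add: blocks_def)
qed (auto simp: blocks_def)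

text \<open>An invariant test cannot see the order of the letters: reindexing by each permutation
  shows that averaging an alternative keeps its error. This passes from arbitrary alternatives to
  symmetric ones, where domination applies.\<close>

lemma sum_symmetrized_test:
  fixes Q Q' :: "'x::finite list pmf"
  assumes Q': "\<And>xs. xs \<in> blocks n \<Longrightarrow>
      pmf Q' xs = 1 / fact n * (\<Sum>\<pi> | \<pi> permutes {..<n}. pmf Q (permute_list \<pi> xs))"
    and T: "\<And>\<pi> xs. \<pi> permutes {..<n} \<Longrightarrow> xs \<in> blocks n \<Longrightarrow> T (permute_list \<pi> xs) = T xs"
  shows "(\<Sum>xs\<in>blocks n. pmf Q' xs * T xs) = (\<Sum>xs\<in>blocks n. pmf Q xs * T xs)"
proof -
  have "(\<Sum>xs\<in>blocks n. pmf Q' xs * T xs)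
      = (\<Sum>xs\<in>blocks n. \<Sum>\<pi> | \<pi> permutes {..<n}. 1 / fact n * (pmf Q (permute_list \<pi> xs) * T (permute_list \<pi> xs)))"
    by (intro sum.cong refl) (simp add: Q' T sum_distrib_left sum_distrib_right mult.assoc)
  also have "\<dots> = (\<Sum>\<pi> | \<pi> permutes {..<n}. \<Sum>xs\<in>blocks n. 1 / fact n * (pmf Q (permute_list \<pi> xs) * T (permute_list \<pi> xs)))"
    by (rule sum.swap)
  also have "\<dots> = (\<Sum>\<pi> | \<pi> permutes {..<n}. \<Sum>xs\<in>blocks n. 1 / fact n * (pmf Q xs * T xs))"
    by (intro sum.cong refl sum.reindex_bij_betw[OF bij_betw_permute_list_blocks, of _ n]) auto
  also have "\<dots> = (\<Sum>xs\<in>blocks n. pmf Q xs * T xs)"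
    by (simp add: card_permutations sum_divide_distrib[symmetric])
  finally show ?thesis .
qed

section \<open>Bounds on the optimal error\<close>

lemma one_minus_type1_error:
  fixes P :: "'x::finite list pmf"
  assumes "P \<in> block_dists n"
  shows "1 - type1_error n P T = (\<Sum>xs\<in>blocks n. pmf P xs * T xs)"
  using sum_pmf_blocks[OF assms] by (simp add: type1_error_def right_diff_distrib sum_subtractf)

lemma test_le_one_minus_opt_type1_error:
  fixes P :: "'x::finite list pmf"
  assumes P: "P \<in> block_dists n" and T: "T \<in> blocks n \<rightarrow> {0..1}"
    and "Qn \<noteq> {}" and "\<And>Q. Q \<in> Qn \<Longrightarrow> (\<Sum>xs\<in>blocks n. pmf Q xs * T xs) \<le> \<mu>"
  shows "(\<Sum>xs\<in>blocks n. pmf P xs * T xs) \<le> 1 - opt_type1_error n \<mu> P Qn"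
proof -
  have "type2_error n Qn T \<le> \<mu>"
    unfolding type2_error_def by (rule cSUP_least) (use assms in auto)
  then have "type1_error n P T \<in> {type1_error n P T | T. T \<in> blocks n \<rightarrow> {0..1} \<and> type2_error n Qn T \<le> \<mu>}"
    using T by blast
  \<comment> \<open>Errors are nonnegative, so the real infimum is a genuine lower bound.\<close>
  moreover have "bdd_below {type1_error n P T | T. T \<in> blocks n \<rightarrow> {0..1} \<and> type2_error n Qn T \<le> \<mu>}"
  proof (rule bdd_belowI[of _ 0])
    fix y assume "y \<in> {type1_error n P T | T. T \<in> blocks n \<rightarrow> {0..1} \<and> type2_error n Qn T \<le> \<mu>}"
    then obtain T' where "y = type1_error n P T'" "T' \<in> blocks n \<rightarrow> {0..1}" by blast
    then show "0 \<le> y"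
      unfolding type1_error_def using Pi_mem[of T' "blocks n" "\<lambda>_. {0..1}"] by (auto intro!: sum_nonneg)
  qed
  ultimately have "opt_type1_error n \<mu> P Qn \<le> type1_error n P T"
    unfolding opt_type1_error_def by (rule cInf_lower)
  then show ?thesis using one_minus_type1_error[OF P, of T] by linarith
qed

lemma one_minus_opt_type1_error_le:
  fixes P :: "'x::finite list pmf"
  assumes P: "P \<in> block_dists n" and Qn: "Qn \<subseteq> block_dists n" "Qn \<noteq> {}" and \<mu>: "0 \<le> \<mu>"
    and bound: "\<And>T. T \<in> blocks n \<rightarrow> {0..1} \<Longrightarrow> (\<And>Q. Q \<in> Qn \<Longrightarrow> (\<Sum>xs\<in>blocks n. pmf Q xs * T xs) \<le> \<mu>)
      \<Longrightarrow> (\<Sum>xs\<in>blocks n. pmf P xs * T xs) \<le> B"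
  shows "1 - opt_type1_error n \<mu> P Qn \<le> B"
proof -
  have "1 - B \<le> opt_type1_error n \<mu> P Qn"
    unfolding opt_type1_error_def
  proof (rule cInf_greatest)
    \<comment> \<open>The zero test is always admissible, so the infimum runs over a nonempty
      set.\<close>
    have "type2_error n Qn (\<lambda>_. 0) \<le> \<mu>" using Qn \<mu> by (simp add: type2_error_def)
    then show "{type1_error n P T | T. T \<in> blocks n \<rightarrow> {0..1} \<and> type2_error n Qn T \<le> \<mu>} \<noteq> {}"
      by (auto intro!: exI[of _ "\<lambda>_. 0"])
  next
    fix y assume "y \<in> {type1_error n P T | T. T \<in> blocks n \<rightarrow> {0..1} \<and> type2_error n Qn T \<le> \<mu>}"
    then obtain T where T: "y = type1_error n P T" "T \<in> blocks n \<rightarrow> {0..1}" "type2_error n Qn T \<le> \<mu>" by blast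
    have "(\<Sum>xs\<in>blocks n. pmf Q xs * T xs) \<le> \<mu>" if "Q \<in> Qn" for Q
    proof -
      \<comment> \<open>Only for a bounded family does the real supremum in
        \<open>type2_error\<close> bound each alternative.\<close>
      have "bdd_above ((\<lambda>Q. \<Sum>xs\<in>blocks n. pmf Q xs * T xs) ` Qn)"
        by (rule bdd_aboveI2[of _ _ 1]) (use Qn(1) T(2) sum_pmf_blocks_test_le_1 in blast)
      then have "(\<Sum>xs\<in>blocks n. pmf Q xs * T xs) \<le> type2_error n Qn T"
        unfolding type2_error_def by (rule cSUP_upper[OF that])
      then show ?thesis using T(3) by linarith
    qed
    then show "1 - B \<le> y" using bound[OF T(2)] one_minus_type1_error[OF P, of T] T(1) by auto
  qed
  then show ?thesis by linarith
qed

section \<open>Convex functions touched from above\<close>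

text \<open>The first-order remainder of \<open>f\<close> lies between those of \<open>g\<close> and
  \<open>h\<close>, so its absolute value is at most the sum of theirs, which is small compared with
  the increment.\<close>

lemma has_derivative_sandwich:
  fixes f g h :: "real \<Rightarrow> real"
  assumes g: "(g has_real_derivative D) (at x)" and h: "(h has_real_derivative D) (at x)"
    and x: "g x = f x" "h x = f x"
    and le: "\<forall>\<^sub>F y in at x. g y \<le> f y \<and> f y \<le> h y"
  shows "(f has_real_derivative D) (at x)"
proof -
  define q where "q f y = norm ((f y - f x) - D * (y - x)) / norm (y - x)" for f :: "real \<Rightarrow> real" and y
  have "(q g \<longlongrightarrow> 0) (at x)" "(q h \<longlongrightarrow> 0) (at x)"
    using g h unfolding has_field_derivative_def has_derivative_iff_norm q_def by auto
  then have "((\<lambda>y. q g y + q h y) \<longlongrightarrow> 0) (at x)" using tendsto_add by fastforce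
  moreover have "\<forall>\<^sub>F y in at x. norm (q f y) \<le> q g y + q h y"
    using le
  proof eventually_elim
    case (elim y)
    then have "norm ((f y - f x) - D * (y - x))
        \<le> norm ((g y - g x) - D * (y - x)) + norm ((h y - h x) - D * (y - x))"
      unfolding x real_norm_def by linarith
    then show ?case by (simp add: q_def add_divide_distrib[symmetric] divide_right_mono)
  qed
  ultimately have "(q f \<longlongrightarrow> 0) (at x)" by (rule Lim_null_comparison[rotated])
  then show ?thesis
    unfolding has_field_derivative_def has_derivative_iff_norm q_def by (simp add: bounded_linear_mult_right)
qed

text \<open>Convexity bounds f from below by the point reflection of the majorant, so both bounds
  have the same derivative at the contact point.\<close>

lemma convex_on_has_derivative_if_touched:
  fixes f g :: "real \<Rightarrow> real"
  assumes f: "convex_on S f" and S: "open S" "x \<in> S"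
    and g: "(g has_real_derivative D) (at x)" "g x = f x" and le: "\<And>y. y \<in> S \<Longrightarrow> f y \<le> g y"
  shows "(f has_real_derivative D) (at x)"
proof (rule has_derivative_sandwich[where g = "\<lambda>y. 2 * g x - g (2 * x - y)" and h = g])
  have "((\<lambda>y. g (2 * x - y)) has_real_derivative D * - 1) (at x)"
    by (rule DERIV_chain2[of g]) (use g in \<open>auto intro!: derivative_eq_intros\<close>)
  then show "((\<lambda>y. 2 * g x - g (2 * x - y)) has_real_derivative D) (at x)"
    by (auto intro!: derivative_eq_intros)
  have "\<forall>\<^sub>F y in nhds x. y \<in> S" using S by (rule eventually_nhds_in_open)
  moreover have "\<forall>\<^sub>F y in nhds x. 2 * x - y \<in> S"
  proof -
    have "((\<lambda>y. 2 * x - y) \<longlongrightarrow> x) (nhds x)"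
      using tendsto_diff[OF tendsto_const[of "2 * x"] filterlim_ident[of "nhds x"]] by simp
    then show ?thesis by (rule topological_tendstoD[OF _ S])
  qed
  ultimately have "\<forall>\<^sub>F y in nhds x. 2 * g x - g (2 * x - y) \<le> f y \<and> f y \<le> g y"
  proof eventually_elim
    case (elim y)
    \<comment> \<open>\<open>x\<close> is the midpoint of \<open>y\<close> and its reflection
      \<open>2 * x - y\<close>, and \<open>g\<close> bounds \<open>f\<close> at the reflected
      point.\<close>
    have "f ((1 - 1 / 2) *\<^sub>R y + (1 / 2) *\<^sub>R (2 * x - y)) \<le> (1 - 1 / 2) * f y + (1 / 2) * f (2 * x - y)"
      by (rule convex_onD[OF f]) (use elim in auto)
    moreover have "(1 - 1 / 2) *\<^sub>R y + (1 / 2) *\<^sub>R (2 * x - y) = x" by (simp add: algebra_simps)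
    ultimately show ?case using le[OF elim(1)] le[OF elim(2)] g(2) by simp
  qed
  then show "\<forall>\<^sub>F y in at x. 2 * g x - g (2 * x - y) \<le> f y \<and> f y \<le> g y"
    by (rule eventually_at_filter[THEN iffD2, OF eventually_mono]) simp
qed (use g in auto)

section \<open>The potential of a dominated family of alternatives\<close>

text \<open>Fixes the witnesses \<open>U\<close> and \<open>v\<close> of universal domination. The
  parametrized family enters through \<open>attained\<close>: at each order in (1, b) there is a
  minimizer with finite Renyi sum.\<close>

locale dominated_alternatives =
  fixes a :: real and P :: "'x::finite pmf" and \<Q> :: "nat \<Rightarrow> 'x list pmf set" and b :: ereal
    and U :: "nat \<Rightarrow> 'x list pmf" and v :: "real poly"
  assumes base: "1 < a" and b: "1 < b"
    and blocks: "\<And>n. 1 \<le> n \<Longrightarrow> \<Q> n \<subseteq> block_dists n"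
    and iid: "iid_closed \<Q>"
    and superadditive: "renyi_superadditive a {s. 1 < s \<and> ereal s < b} P \<Q>"
    and U_sym: "\<And>n. 1 \<le> n \<Longrightarrow> U n \<in> sym_dists n"
    and U_dominates: "\<And>n Q xs. 1 \<le> n \<Longrightarrow> Q \<in> \<Q> n \<inter> sym_dists n \<Longrightarrow> xs \<in> blocks n \<Longrightarrow>
      pmf Q xs \<le> poly v (real n) * pmf (U n) xs"
    and U_far: "\<And>n s. 1 \<le> n \<Longrightarrow> 1 < s \<Longrightarrow> ereal s < b \<Longrightarrow>
      renyi_div_set a s (replicate_pmf n P) (\<Q> n) \<le> renyi_div a s (replicate_pmf n P) (U n)"
    and symmetrization: "\<And>n Q. 1 \<le> n \<Longrightarrow> Q \<in> \<Q> n \<Longrightarrow> \<exists>Q'\<in>\<Q> n \<inter> sym_dists n. \<forall>xs\<in>blocks n.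
      pmf Q' xs = 1 / fact n * (\<Sum>\<pi> | \<pi> permutes {..<n}. pmf Q (permute_list \<pi> xs))"
    and attained: "\<And>s. 1 < s \<Longrightarrow> ereal s < b \<Longrightarrow> \<exists>Q\<in>single_letter \<Q>. renyi_sum s P Q \<noteq> \<infinity> \<and>
      (\<forall>Q'\<in>single_letter \<Q>. renyi_div a s P Q \<le> renyi_div a s P Q')"
begin

abbreviation S :: "real set" where
  "S \<equiv> {s. 1 < s \<and> ereal s < b}"

abbreviation \<phi> :: "real \<Rightarrow> real" where
  "\<phi> \<equiv> renyi_potential a P (single_letter \<Q>)"

abbreviation letter_sum :: "'x pmf \<Rightarrow> real \<Rightarrow> real" where
  "letter_sum Q \<equiv> chernoff_sum UNIV (pmf P) (pmf Q)"

abbreviation block_sum :: "nat \<Rightarrow> real \<Rightarrow> real" where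
  "block_sum n \<equiv> chernoff_sum (blocks n) (pmf (replicate_pmf n P)) (pmf (U n))"

section \<open>Minimizers and the single-letter potential\<close>

lemma open_S: "open S"
proof -
  have "S = {1<..} \<inter> ereal -` {..<b}" by auto
  then show ?thesis using open_Int[OF open_greaterThan open_ereal_vimage[OF open_lessThan]] by simp
qed

lemma convex_S: "convex S"
proof -
  have "is_interval S"
    unfolding is_interval_1 using le_less_trans[of "ereal _" "ereal _" b] by fastforce
  then show ?thesis by (rule is_interval_convex)
qed

lemma letter_sum_pos: "set_pmf P \<subseteq> set_pmf Q \<Longrightarrow> 0 < letter_sum Q s"
  by (rule chernoff_sum_pmf_pos) auto

text \<open>Finiteness of the Renyi sum at order above 1 makes the minimizer absolutely continuous,
  so the potential is the logarithm of a positive finite sum.\<close>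

lemma minimizer:
  assumes s: "s \<in> S"
  obtains Q where "Q \<in> single_letter \<Q>" "set_pmf P \<subseteq> set_pmf Q" "letter_sum Q s = a powr \<phi> s"
    "renyi_div_set a s P (single_letter \<Q>) = ereal (\<phi> s / (s - 1))"
proof -
  have s': "1 < s" "ereal s < b" using s by auto
  obtain Q where Q: "Q \<in> single_letter \<Q>" "renyi_sum s P Q \<noteq> \<infinity>"
      "\<And>Q'. Q' \<in> single_letter \<Q> \<Longrightarrow> renyi_div a s P Q \<le> renyi_div a s P Q'"
    using attained[OF s'] by blast
  have ac: "set_pmf P \<subseteq> set_pmf Q"
  proof (rule ccontr)
    assume "\<not> set_pmf P \<subseteq> set_pmf Q"
    then have "\<exists>x. 0 < pmf P x \<and> pmf Q x = 0" by (auto simp: set_pmf_iff less_le)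
    then show False using Q(2) s' by (simp add: renyi_sum_def)
  qed
  have set_eq: "renyi_div_set a s P (single_letter \<Q>) = renyi_div a s P Q"
    unfolding renyi_div_set_def by (rule antisym) (use Q in \<open>auto intro: INF_lower INF_greatest\<close>)
  also have "\<dots> = ereal (log a (letter_sum Q s) / (s - 1))"
    by (rule renyi_div_eq_log_chernoff_sum) (use ac s' in auto)
  finally have div: "renyi_div_set a s P (single_letter \<Q>) = ereal (log a (letter_sum Q s) / (s - 1))" .
  then have \<phi>: "\<phi> s = log a (letter_sum Q s)"
    using s' by (simp add: renyi_potential_def)
  then have "letter_sum Q s = a powr \<phi> s"
    using letter_sum_pos[OF ac, of s] base by simp
  then show thesis using that[OF Q(1) ac] div \<phi> by simp
qed

text \<open>Keeping one alternative fixed while the order varies gives a smooth majorant of the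
  potential.\<close>

lemma powr_potential_le:
  assumes s: "s \<in> S" and Q: "Q \<in> single_letter \<Q>" "set_pmf P \<subseteq> set_pmf Q"
  shows "a powr \<phi> s \<le> letter_sum Q s"
proof -
  obtain Q\<^sub>s where "renyi_div_set a s P (single_letter \<Q>) = ereal (\<phi> s / (s - 1))"
    using minimizer[OF s] by blast
  moreover have "renyi_div_set a s P (single_letter \<Q>) \<le> renyi_div a s P Q"
    unfolding renyi_div_set_def by (rule INF_lower[OF Q(1)])
  moreover have "renyi_div a s P Q = ereal (log a (letter_sum Q s) / (s - 1))"
    by (rule renyi_div_eq_log_chernoff_sum) (use Q s in auto)
  ultimately have "\<phi> s \<le> log a (letter_sum Q s)" using s by (simp add: divide_le_cancel)
  then show ?thesis using base letter_sum_pos[OF Q(2), of s] by (simp add: le_log_iff)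
qed

text \<open>The Hoelder bound for the constant test 1 reads
  \<open>1 \<le> letter_sum Q s powr (1 / s)\<close>.\<close>

lemma potential_nonneg:
  assumes s: "s \<in> S"
  shows "0 \<le> \<phi> s"
proof -
  obtain Q where Q: "set_pmf P \<subseteq> set_pmf Q" "letter_sum Q s = a powr \<phi> s"
    using minimizer[OF s] by blast
  have total: "(\<Sum>x\<in>UNIV. pmf R x) = 1" for R :: "'x pmf" by (rule sum_pmf_eq_1) auto
  have "(\<Sum>x\<in>UNIV. pmf P x * 1) \<le> letter_sum Q s powr (1 / s) * (\<Sum>x\<in>UNIV. pmf Q x * 1) powr (1 - 1 / s)"
    by (rule weighted_sum_le_chernoff_sum) (use Q(1) s in \<open>auto simp: set_pmf_iff\<close>)
  then have "a powr 0 \<le> a powr (\<phi> s / s)"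
    using base by (simp add: total Q(2) powr_powr)
  then have "0 \<le> \<phi> s / s" using base by (simp only: powr_le_cancel_iff)
  then show ?thesis using s by (simp add: zero_le_divide_iff)
qed

lemma eventually_at_right_1_S: "\<forall>\<^sub>F s in at_right 1. s \<in> S"
proof -
  obtain s\<^sub>1 where "1 < ereal s\<^sub>1" "ereal s\<^sub>1 < b" using ereal_dense2[OF b] by auto
  then have "\<forall>s>1. s < s\<^sub>1 \<longrightarrow> s \<in> S" "1 < s\<^sub>1"
    using less_trans[of "ereal _" "ereal s\<^sub>1" b] by auto
  then show ?thesis unfolding eventually_at_right_field by blast
qed

text \<open>One fixed absolutely continuous \<open>Q\<close> gives a continuous upper bound whose
  value at order 1 is the logarithm of the total mass of \<open>P\<close>; the lower bound is
  0.\<close>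

lemma potential_tendsto_0: "(\<phi> \<longlongrightarrow> 0) (at_right 1)"
proof -
  obtain s\<^sub>1 where s1: "s\<^sub>1 \<in> S"
    using eventually_happens'[OF _ eventually_at_right_1_S] by auto
  obtain Q where Q: "Q \<in> single_letter \<Q>" "set_pmf P \<subseteq> set_pmf Q" using minimizer[OF s1] by blast
  have "letter_sum Q 1 = (\<Sum>x\<in>UNIV. pmf P x)"
    unfolding chernoff_sum_def by (rule sum.cong) (use Q(2) in \<open>auto simp: set_pmf_iff\<close>)
  then have one: "letter_sum Q 1 = 1" by (simp add: sum_pmf_eq_1)
  have "isCont (letter_sum Q) 1" by (rule DERIV_isCont[OF chernoff_sum_has_derivative]) auto
  then have "(letter_sum Q \<longlongrightarrow> 1) (at_right 1)"
    unfolding isCont_def one by (rule filterlim_mono) (auto simp: at_within_le_at)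
  then have lim: "((\<lambda>s. log a (letter_sum Q s)) \<longlongrightarrow> log a 1) (at_right 1)"
    using base by (intro tendsto_log tendsto_const) auto
  have upper: "\<forall>\<^sub>F s in at_right 1. \<phi> s \<le> log a (letter_sum Q s)"
    using eventually_at_right_1_S
  proof eventually_elim
    case (elim s)
    show ?case
      using powr_potential_le[OF elim Q] base letter_sum_pos[OF Q(2), of s] by (simp add: le_log_iff)
  qed
  have lower: "\<forall>\<^sub>F s in at_right 1. 0 \<le> \<phi> s"
    using eventually_at_right_1_S by eventually_elim (rule potential_nonneg)
  show ?thesis
    by (rule tendsto_sandwich[OF lower upper tendsto_const]) (use lim in simp)
qed

section \<open>Comparison with the dominating distribution\<close>

lemma U_block: "1 \<le> n \<Longrightarrow> U n \<in> block_dists n"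
  using U_sym[of n] by (simp add: sym_dists_def)

lemma iid_in:
  assumes "1 \<le> n" "Q \<in> single_letter \<Q>"
  shows "replicate_pmf n Q \<in> \<Q> n \<inter> sym_dists n"
  using iid assms replicate_pmf_in_sym_dists by (auto simp: iid_closed_def)

lemma single_letter_nonempty: "\<exists>Q. Q \<in> single_letter \<Q> \<and> set_pmf P \<subseteq> set_pmf Q"
proof -
  obtain s where "s \<in> S" using eventually_happens'[OF _ eventually_at_right_1_S] by auto
  then show ?thesis by (rule minimizer) blast
qed

lemma alternatives_nonempty: "1 \<le> n \<Longrightarrow> \<Q> n \<noteq> {}"
  using single_letter_nonempty iid_in by blast

text \<open>Summing the domination of an i.i.d. alternative over all blocks compares two total
  masses, both equal to 1.\<close>

lemma poly_v_ge_1: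
  assumes "1 \<le> n"
  shows "1 \<le> poly v (real n)"
proof -
  obtain Q where Q: "Q \<in> single_letter \<Q>" using single_letter_nonempty by blast
  have "1 = (\<Sum>xs\<in>blocks n. pmf (replicate_pmf n Q) xs)"
    by (simp add: sum_pmf_blocks replicate_pmf_in_block_dists)
  also have "\<dots> \<le> (\<Sum>xs\<in>blocks n. poly v (real n) * pmf (U n) xs)"
    by (intro sum_mono U_dominates assms iid_in Q)
  also have "\<dots> = poly v (real n)"
    by (simp add: sum_distrib_left[symmetric] sum_pmf_blocks[OF U_block[OF assms]])
  finally show ?thesis .
qed

lemma set_replicate_pmf_subset_U:
  assumes n: "1 \<le> n"
  shows "set_pmf (replicate_pmf n P) \<subseteq> set_pmf (U n)"
proof
  fix xs assume xs: "xs \<in> set_pmf (replicate_pmf n P)"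
  obtain Q where Q: "Q \<in> single_letter \<Q>" "set_pmf P \<subseteq> set_pmf Q" using single_letter_nonempty by blast
  have "0 < pmf (replicate_pmf n Q) xs"
    using xs set_replicate_pmf_mono[OF Q(2)] by (intro pmf_positive) auto
  also have "\<dots> \<le> poly v (real n) * pmf (U n) xs"
    using xs set_replicate_pmf_subset_blocks by (intro U_dominates n iid_in Q) blast
  finally show "xs \<in> set_pmf (U n)" by (auto simp: set_pmf_iff)
qed

lemma block_sum_pos: "1 \<le> n \<Longrightarrow> 0 < block_sum n s"
  by (rule chernoff_sum_pmf_pos[OF finite_blocks set_replicate_pmf_subset_blocks set_replicate_pmf_subset_U])

text \<open>Superadditivity bounds the divergence from \<open>\<Q> n\<close> below by
  \<open>n\<close> times the single-letter one, and \<open>U n\<close> is at least as far from the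
  i.i.d. distribution as \<open>\<Q> n\<close> is.\<close>

lemma block_sum_ge:
  assumes n: "1 \<le> n" and s: "s \<in> S"
  shows "a powr (real n * \<phi> s) \<le> block_sum n s"
proof -
  have s': "1 < s" "ereal s < b" using s by auto
  obtain Q where div: "renyi_div_set a s P (single_letter \<Q>) = ereal (\<phi> s / (s - 1))"
    using minimizer[OF s] by blast
  have "ereal (real n) * renyi_div_set a s P (single_letter \<Q>) \<le> renyi_div_set a s (replicate_pmf n P) (\<Q> n)"
    using superadditive s n unfolding renyi_superadditive_def by blast
  also have "\<dots> \<le> renyi_div a s (replicate_pmf n P) (U n)" by (rule U_far[OF n s'])
  also have "\<dots> = ereal (log a (block_sum n s) / (s - 1))"
    by (rule renyi_div_eq_log_chernoff_sum[OF finite_blocks set_replicate_pmf_subset_blocks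
          set_replicate_pmf_subset_U[OF n] s'(1)])
  finally have "real n * \<phi> s \<le> log a (block_sum n s)"
    using s' by (simp add: div divide_le_cancel)
  then show ?thesis using base block_sum_pos[OF n] by (simp add: le_log_iff)
qed

text \<open>Domination lets the i.i.d. power of the minimizer replace \<open>U n\<close> at the
  price of a polynomial factor, and for i.i.d. pairs the sum is exact.\<close>

lemma block_sum_le:
  assumes n: "1 \<le> n" and s: "s \<in> S"
  shows "block_sum n s \<le> poly v (real n) powr (s - 1) * a powr (real n * \<phi> s)"
proof -
  obtain Q where Q: "Q \<in> single_letter \<Q>" "set_pmf P \<subseteq> set_pmf Q" "letter_sum Q s = a powr \<phi> s"
    using minimizer[OF s] by blast
  let ?P = "pmf (replicate_pmf n P)" and ?Q = "pmf (replicate_pmf n Q)" and ?v = "poly v (real n)"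
  have v: "0 < ?v" using poly_v_ge_1[OF n] by simp
  have "?P xs powr s * pmf (U n) xs powr (1 - s) \<le> ?v powr (s - 1) * (?P xs powr s * ?Q xs powr (1 - s))"
    if xs: "xs \<in> blocks n" for xs
  proof (cases "?P xs = 0")
    case False
    then have "0 < ?Q xs"
      by (intro pmf_positive subsetD[OF set_replicate_pmf_mono[OF Q(2)]]) (simp add: set_pmf_iff)
    moreover have "?Q xs \<le> ?v * pmf (U n) xs" by (intro U_dominates n iid_in Q xs)
    \<comment> \<open>The exponent \<open>1 - s\<close> is negative, so domination reverses.\<close>
    ultimately have "(?v * pmf (U n) xs) powr (1 - s) \<le> ?Q xs powr (1 - s)"
      using s by (intro powr_mono2') auto
    then have "?v powr (s - 1) * (?v powr (1 - s) * pmf (U n) xs powr (1 - s)) \<le> ?v powr (s - 1) * ?Q xs powr (1 - s)"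
      by (intro mult_left_mono) (auto simp: powr_mult)
    moreover have "?v powr (s - 1) * (?v powr (1 - s) * pmf (U n) xs powr (1 - s)) = pmf (U n) xs powr (1 - s)"
      using v by (simp add: powr_add[symmetric] flip: mult.assoc)
    ultimately have "pmf (U n) xs powr (1 - s) \<le> ?v powr (s - 1) * ?Q xs powr (1 - s)" by linarith
    then have "?P xs powr s * pmf (U n) xs powr (1 - s) \<le> ?P xs powr s * (?v powr (s - 1) * ?Q xs powr (1 - s))"
      by (rule mult_left_mono) simp
    then show ?thesis by (simp only: mult_ac)
  qed simp
  then have "block_sum n s \<le> ?v powr (s - 1) * chernoff_sum (blocks n) ?P ?Q s"
    unfolding chernoff_sum_def sum_distrib_left by (rule sum_mono)
  also have "chernoff_sum (blocks n) ?P ?Q s = a powr (real n * \<phi> s)"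
    using base by (simp add: chernoff_sum_replicate_pmf Q(3) powr_power mult.commute)
  finally show ?thesis .
qed

section \<open>Convexity and differentiability of the potential\<close>

lemma eventually_v_le:
  assumes "0 < d" "0 < k" "0 < e"
  shows "\<forall>\<^sub>F n in sequentially. poly v (real n) powr k * a powr (- (real n * d)) \<le> e"
proof (rule eventually_poly_powr_le[OF base assms])
  show "\<forall>\<^sub>F n in sequentially. 0 < poly v (real n)"
    using eventually_ge_at_top[of 1] by eventually_elim (use poly_v_ge_1 in force)
qed

text \<open>Log-convexity of \<open>block_sum\<close> transfers to its exponential rate: a violation
  of size \<open>d\<close> would cost a factor \<open>a powr (real n * d)\<close>, while the two
  block bounds differ only polynomially.\<close>

lemma convex_potential: "convex_on S \<phi>"
proof (rule convex_onI)
  fix t x y :: real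
  assume t: "0 < t" "t < 1" and x: "x \<in> S" and y: "y \<in> S"
  define z where "z = (1 - t) * x + t * y"
  have z: "z \<in> S" using convexD_alt[OF convex_S x y, of t] t by (simp add: z_def)
  show "\<phi> ((1 - t) *\<^sub>R x + t *\<^sub>R y) \<le> (1 - t) * \<phi> x + t * \<phi> y"
  proof (rule ccontr)
    assume not: "\<not> ?thesis"
    define d where "d = \<phi> z - ((1 - t) * \<phi> x + t * \<phi> y)"
    have d: "0 < d" using not by (simp add: d_def z_def)
    have "\<forall>\<^sub>F n in sequentially. poly v (real n) powr (z - 1) * a powr (- (real n * d)) \<le> 1 / 2"
      by (rule eventually_v_le) (use d z in auto)
    moreover have "\<forall>\<^sub>F n in sequentially. 1 \<le> poly v (real n) powr (z - 1) * a powr (- (real n * d))"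
      using eventually_ge_at_top[of 1]
    proof eventually_elim
      case (elim n)
      let ?v = "poly v (real n)"
      have "a powr (real n * \<phi> z) \<le> block_sum n z" by (rule block_sum_ge[OF elim z])
      also have "\<dots> \<le> block_sum n x powr (1 - t) * block_sum n y powr t"
        unfolding z_def by (rule chernoff_sum_log_convex) (use t in auto)
      also have "\<dots> \<le> (?v powr (x - 1) * a powr (real n * \<phi> x)) powr (1 - t)
          * (?v powr (y - 1) * a powr (real n * \<phi> y)) powr t"
        by (intro mult_mono powr_mono2 block_sum_le elim x y) (use t in \<open>auto simp: chernoff_sum_nonneg\<close>)
      also have "\<dots> = ?v powr ((x - 1) * (1 - t) + (y - 1) * t)
          * a powr (real n * \<phi> x * (1 - t) + real n * \<phi> y * t)"
        by (simp only: powr_mult powr_powr powr_add mult_ac)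
      also have "(x - 1) * (1 - t) + (y - 1) * t = z - 1" by (simp add: z_def algebra_simps)
      also have "real n * \<phi> x * (1 - t) + real n * \<phi> y * t = real n * \<phi> z - real n * d"
        by (simp add: d_def algebra_simps)
      finally have "a powr (real n * \<phi> z) * 1
          \<le> a powr (real n * \<phi> z) * (?v powr (z - 1) * a powr (- (real n * d)))"
        by (simp add: powr_diff powr_minus divide_inverse mult_ac)
      then show ?case using base by (simp only: mult_le_cancel_left_pos powr_gt_zero)
    qed
    ultimately have "\<forall>\<^sub>F n in sequentially. False" by eventually_elim simp
    then show False by simp
  qed
qed (rule convex_S)

text \<open>The touching majorant is the logarithm of \<open>letter_sum Q\<close>, with
  \<open>Q\<close> the minimizer at \<open>s\<close> held fixed.\<close>

lemma potential_has_derivative: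
  assumes s: "s \<in> S"
  shows "(\<phi> has_real_derivative deriv \<phi> s) (at s)"
proof -
  obtain Q where Q: "Q \<in> single_letter \<Q>" "set_pmf P \<subseteq> set_pmf Q" "letter_sum Q s = a powr \<phi> s"
    using minimizer[OF s] by blast
  obtain D where "(letter_sum Q has_real_derivative D) (at s)"
    by (rule that[OF chernoff_sum_has_derivative]) simp_all
  then have "((\<lambda>s. ln (letter_sum Q s)) has_real_derivative 1 / letter_sum Q s * D) (at s)"
    by (rule DERIV_chain2[of ln _ "letter_sum Q" s, OF DERIV_ln_divide[OF letter_sum_pos[OF Q(2)]]])
  then have "((\<lambda>s. log a (letter_sum Q s)) has_real_derivative 1 / letter_sum Q s * D / ln a) (at s)"
    unfolding log_def by (rule DERIV_cdivide)
  moreover have "log a (letter_sum Q s) = \<phi> s" using base by (simp add: Q(3))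
  moreover have "\<phi> t \<le> log a (letter_sum Q t)" if "t \<in> S" for t
    using powr_potential_le[OF that Q(1,2)] base letter_sum_pos[OF Q(2), of t] by (simp add: le_log_iff)
  ultimately have D: "(\<phi> has_real_derivative 1 / letter_sum Q s * D / ln a) (at s)"
    by (intro convex_on_has_derivative_if_touched[OF convex_potential open_S s])
  show ?thesis using D unfolding DERIV_imp_deriv[OF D] .
qed

lemma potential_above_tangent:
  assumes "s \<in> S" "t \<in> S"
  shows "\<phi> s + deriv \<phi> s * (t - s) \<le> \<phi> t"
proof -
  have "\<phi> t - \<phi> s \<ge> deriv \<phi> s * (t - s)"
    by (rule convex_on_imp_above_tangent[OF convex_potential convex_connected[OF convex_S]])
      (use assms open_S potential_has_derivative in \<open>auto simp: interior_open intro: has_field_derivative_at_within\<close>)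
  then show ?thesis by simp
qed

section \<open>The strong converse exponent\<close>

definition exponent_seq :: "real \<Rightarrow> nat \<Rightarrow> real" where
  "exponent_seq R n = - (1 / real n) *
     log a (1 - opt_type1_error n (a powr (- (real n * R))) (replicate_pmf n P) (\<Q> n))"

lemma strong_converse_exponent_eq:
  "strong_converse_exponent a P \<Q> R = limsup (\<lambda>n. ereal (exponent_seq R n))"
  by (simp add: strong_converse_exponent_def exponent_seq_def)

lemma exponent_seq_le:
  assumes n: "1 \<le> n" and T: "T \<in> blocks n \<rightarrow> {0..1}"
    and null: "\<And>Q. Q \<in> \<Q> n \<Longrightarrow> (\<Sum>xs\<in>blocks n. pmf Q xs * T xs) \<le> a powr (- (real n * R))"
    and B: "a powr (- (real n * B)) \<le> (\<Sum>xs\<in>blocks n. pmf (replicate_pmf n P) xs * T xs)"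
  shows "exponent_seq R n \<le> B"
proof -
  have "a powr (- (real n * B)) \<le> 1 - opt_type1_error n (a powr (- (real n * R))) (replicate_pmf n P) (\<Q> n)"
    using B test_le_one_minus_opt_type1_error[OF replicate_pmf_in_block_dists T alternatives_nonempty[OF n] null, of P]
    by linarith
  moreover from this have "0 < 1 - opt_type1_error n (a powr (- (real n * R))) (replicate_pmf n P) (\<Q> n)"
    using base by (intro less_le_trans[OF powr_gt_zero[THEN iffD2]]) auto
  ultimately have "- (real n * B) \<le> log a (1 - opt_type1_error n (a powr (- (real n * R))) (replicate_pmf n P) (\<Q> n))"
    using base by (simp only: le_log_iff)
  then show ?thesis using n by (simp add: exponent_seq_def field_simps)
qed

text \<open>The converse at each block length: the i.i.d. power of the minimizer is itself an
  alternative, so every admissible test has error at most \<open>\<mu>\<close> under it, and the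
  Hoelder bound limits its power.\<close>

lemma exponent_seq_ge:
  assumes n: "1 \<le> n" and s: "s \<in> S" and R: "0 < R"
  shows "(s - 1) / s * R - \<phi> s / s \<le> exponent_seq R n"
proof -
  have s': "1 < s" using s by simp
  define \<mu> where "\<mu> = a powr (- (real n * R))"
  define p where "p = 1 - opt_type1_error n \<mu> (replicate_pmf n P) (\<Q> n)"
  \<comment> \<open>The negated objective, that is, the exponential rate of the bound on the
    power.\<close>
  define B where "B = (\<phi> s - (s - 1) * R) / s"
  have \<mu>: "0 < \<mu>" "\<mu> \<le> 1" using base R powr_mono[of "- (real n * R)" 0 a] by (auto simp: \<mu>_def)
  obtain Q where Q: "Q \<in> single_letter \<Q>" "set_pmf P \<subseteq> set_pmf Q" "letter_sum Q s = a powr \<phi> s"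
    using minimizer[OF s] by blast
  \<comment> \<open>The constant test \<open>\<mu>\<close> is admissible because
    \<open>R > 0\<close> gives \<open>\<mu> \<le> 1\<close>; hence \<open>p\<close> is positive and
    its logarithm is meaningful.\<close>
  have "(\<Sum>xs\<in>blocks n. pmf (replicate_pmf n P) xs * \<mu>) \<le> p"
    unfolding p_def
  proof (rule test_le_one_minus_opt_type1_error[OF replicate_pmf_in_block_dists])
    show "(\<Sum>xs\<in>blocks n. pmf Q xs * \<mu>) \<le> \<mu>" if "Q \<in> \<Q> n" for Q
      using that blocks[OF n] by (auto simp: sum_distrib_right[symmetric] sum_pmf_blocks)
  qed (use \<mu> alternatives_nonempty[OF n] in auto)
  then have p_pos: "0 < p"
    using \<mu> by (simp add: sum_distrib_right[symmetric] sum_pmf_blocks replicate_pmf_in_block_dists)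
  have "p \<le> a powr (real n * B)"
    unfolding p_def
  proof (rule one_minus_opt_type1_error_le[OF replicate_pmf_in_block_dists blocks[OF n] alternatives_nonempty[OF n]])
    fix T :: "'x list \<Rightarrow> real" assume T: "T \<in> blocks n \<rightarrow> {0..1}"
      and null: "\<And>Q. Q \<in> \<Q> n \<Longrightarrow> (\<Sum>xs\<in>blocks n. pmf Q xs * T xs) \<le> \<mu>"
    let ?Q = "replicate_pmf n Q"
    have le: "(\<Sum>xs\<in>blocks n. pmf ?Q xs * T xs) \<le> \<mu>" using null iid_in[OF n Q(1)] by blast
    have "(\<Sum>xs\<in>blocks n. pmf (replicate_pmf n P) xs * T xs)
        \<le> chernoff_sum (blocks n) (pmf (replicate_pmf n P)) (pmf ?Q) s powr (1 / s)
          * (\<Sum>xs\<in>blocks n. pmf ?Q xs * T xs) powr (1 - 1 / s)"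
      by (rule weighted_sum_le_chernoff_sum)
        (use T s set_replicate_pmf_mono[OF Q(2), of n] in \<open>auto simp: set_pmf_iff\<close>)
    also have "\<dots> \<le> chernoff_sum (blocks n) (pmf (replicate_pmf n P)) (pmf ?Q) s powr (1 / s) * \<mu> powr (1 - 1 / s)"
      by (intro mult_left_mono powr_mono2 le sum_nonneg) (use T s in \<open>auto simp: Pi_iff\<close>)
    also have "chernoff_sum (blocks n) (pmf (replicate_pmf n P)) (pmf ?Q) s = a powr (real n * \<phi> s)"
      using base by (simp add: chernoff_sum_replicate_pmf Q(3) powr_power mult.commute)
    also have "(a powr (real n * \<phi> s)) powr (1 / s) * \<mu> powr (1 - 1 / s)
        = a powr (real n * \<phi> s * (1 / s) + - (real n * R) * (1 - 1 / s))"
      by (simp only: \<mu>_def powr_powr powr_add)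
    also have "real n * \<phi> s * (1 / s) + - (real n * R) * (1 - 1 / s) = real n * B"
      using s' by (simp add: B_def field_simps)
    finally show "(\<Sum>xs\<in>blocks n. pmf (replicate_pmf n P) xs * T xs) \<le> a powr (real n * B)" .
  qed (use \<mu> in simp)
  then have "log a p \<le> real n * B" using base p_pos by (simp add: log_le_iff)
  then have "- B \<le> exponent_seq R n"
    using n by (simp add: exponent_seq_def p_def \<mu>_def field_simps)
  moreover have "- B = (s - 1) / s * R - \<phi> s / s" using s' by (simp add: B_def field_simps)
  ultimately show ?thesis by simp
qed

section \<open>Concentration of the tilted distribution\<close>

lemma derivative_window:
  assumes s: "s \<in> S" and e: "0 < e"
  obtains t where "0 < t" "s + t \<in> S" "s - t \<in> S"
    "\<phi> (s + t) \<le> \<phi> s + t * (deriv \<phi> s + e)" "\<phi> (s - t) \<le> \<phi> s - t * (deriv \<phi> s - e)"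
proof -
  have "((\<lambda>t. (\<phi> (s + t) - \<phi> s) / t) \<longlongrightarrow> deriv \<phi> s) (at 0)"
    using potential_has_derivative[OF s] by (simp add: DERIV_def)
  then have "\<forall>\<^sub>F t in at 0. dist ((\<phi> (s + t) - \<phi> s) / t) (deriv \<phi> s) < e"
    by (rule tendstoD[OF _ e])
  then obtain d1 where d1: "0 < d1"
      "\<And>t. t \<noteq> 0 \<Longrightarrow> \<bar>t\<bar> < d1 \<Longrightarrow> \<bar>(\<phi> (s + t) - \<phi> s) / t - deriv \<phi> s\<bar> < e"
    unfolding eventually_at by (auto simp: dist_real_def)
  obtain d2 where d2: "0 < d2" "\<And>x. \<bar>x - s\<bar> < d2 \<Longrightarrow> x \<in> S"
    using open_S s unfolding open_dist dist_real_def by metis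
  \<comment> \<open>Half the smaller radius serves both directions at once and keeps both shifted
    orders in \<open>S\<close>.\<close>
  define t where "t = min d1 d2 / 2"
  have t: "0 < t" "t < d1" "t < d2" using d1(1) d2(1) by (auto simp: t_def)
  have "(\<phi> (s + t) - \<phi> s) / t < deriv \<phi> s + e" using d1(2)[of t] t by (simp add: abs_less_iff)
  then have up: "\<phi> (s + t) \<le> \<phi> s + t * (deriv \<phi> s + e)" using t(1) by (simp add: field_simps)
  have "(\<phi> (s - t) - \<phi> s) / (- t) > deriv \<phi> s - e" using d1(2)[of "- t"] t by (simp add: abs_less_iff)
  then have down: "\<phi> (s - t) \<le> \<phi> s - t * (deriv \<phi> s - e)" using t(1) by (simp add: field_simps)
  have "s + t \<in> S" "s - t \<in> S" by (rule d2(2); use t in simp)+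
  then show thesis by (rule that[OF t(1) _ _ up down])
qed

text \<open>At the window's edges the first-order expansion of the potential leaves a margin that
  beats the polynomial, so each tail takes at most a quarter of
  \<open>a powr (real n * \<phi> s)\<close> and half of it remains inside.\<close>

lemma tilted_test:
  assumes s: "s \<in> S" and e: "0 < e"
  defines "c \<equiv> deriv \<phi> s"
  defines "E \<equiv> \<lambda>n. {xs. a powr (real n * (c - e)) * pmf (U n) xs \<le> pmf (replicate_pmf n P) xs \<and>
    pmf (replicate_pmf n P) xs \<le> a powr (real n * (c + e)) * pmf (U n) xs}"
  shows "\<forall>\<^sub>F n in sequentially.
      1 / 2 * a powr (real n * (\<phi> s - (s - 1) * (c + e))) \<le> sum (pmf (replicate_pmf n P)) (blocks n \<inter> E n) \<and>
      sum (pmf (U n)) (blocks n \<inter> E n)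
        \<le> poly v (real n) powr (s - 1) * a powr (real n * (\<phi> s - s * (c - e)))"
proof -
  \<comment> \<open>The expansion has error \<open>e / 2\<close> and the window half-width
    \<open>e\<close>; the difference is the decay rate \<open>t * e / 2\<close> of the
    tails.\<close>
  obtain t where t: "0 < t" "s + t \<in> S" "s - t \<in> S"
      and up: "\<phi> (s + t) \<le> \<phi> s + t * (c + e / 2)" and down: "\<phi> (s - t) \<le> \<phi> s - t * (c - e / 2)"
    using derivative_window[OF s, of "e / 2"] e unfolding c_def by auto
  have te: "0 < t * e / 2" using t e by simp
  have "\<forall>\<^sub>F n in sequentially. poly v (real n) powr (s + t - 1) * a powr (- (real n * (t * e / 2))) \<le> 1 / 4"
    by (rule eventually_v_le[OF te]) (use t in auto)
  moreover have "\<forall>\<^sub>F n in sequentially. poly v (real n) powr (s - t - 1) * a powr (- (real n * (t * e / 2))) \<le> 1 / 4"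
    by (rule eventually_v_le[OF te]) (use t in auto)
  ultimately show ?thesis
    using eventually_ge_at_top[of 1]
  proof eventually_elim
    case (elim n)
    let ?v = "poly v (real n)" and ?g = "a powr (real n * \<phi> s)"
    define l where "l = a powr (real n * (c - e))"
    define r where "r = a powr (real n * (c + e))"
    have lr: "0 < l" "0 < r" using base by (auto simp: l_def r_def)
    have ac: "pmf (replicate_pmf n P) xs = 0" if "pmf (U n) xs = 0" for xs
      using set_replicate_pmf_subset_U[OF elim(3)] that by (auto simp: set_pmf_iff)
    have s': "1 < s" using s by simp
    note window = likelihood_window[of "blocks n" "pmf (replicate_pmf n P)" "pmf (U n)" l r s t,
        OF finite_blocks pmf_nonneg pmf_nonneg ac lr s' t(1)]
    have E: "{xs. l * pmf (U n) xs \<le> pmf (replicate_pmf n P) xs \<and> pmf (replicate_pmf n P) xs \<le> r * pmf (U n) xs} = E n"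
      by (simp add: E_def l_def r_def)
    have "r powr (- t) * block_sum n (s + t)
        \<le> r powr (- t) * (?v powr (s + t - 1) * a powr (real n * (\<phi> s + t * (c + e / 2))))"
      using base by (intro mult_left_mono order_trans[OF block_sum_le[OF elim(3) t(2)]] mult_left_mono)
        (auto intro!: mult_left_mono up)
    also have "\<dots> = ?v powr (s + t - 1) * a powr (real n * (c + e) * (- t) + real n * (\<phi> s + t * (c + e / 2)))"
      by (simp only: r_def powr_powr powr_add mult_ac)
    also have "real n * (c + e) * (- t) + real n * (\<phi> s + t * (c + e / 2)) = - (real n * (t * e / 2)) + real n * \<phi> s"
      by (simp add: algebra_simps)
    also have "?v powr (s + t - 1) * a powr (- (real n * (t * e / 2)) + real n * \<phi> s)
        = ?v powr (s + t - 1) * a powr (- (real n * (t * e / 2))) * ?g"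
      by (simp only: powr_add mult.assoc)
    also have "\<dots> \<le> 1 / 4 * ?g" by (rule mult_right_mono[OF elim(1)]) simp
    finally have upper: "r powr (- t) * block_sum n (s + t) \<le> 1 / 4 * ?g" .
    have "l powr t * block_sum n (s - t)
        \<le> l powr t * (?v powr (s - t - 1) * a powr (real n * (\<phi> s - t * (c - e / 2))))"
      using base by (intro mult_left_mono order_trans[OF block_sum_le[OF elim(3) t(3)]] mult_left_mono)
        (auto intro!: mult_left_mono down)
    also have "\<dots> = ?v powr (s - t - 1) * a powr (real n * (c - e) * t + real n * (\<phi> s - t * (c - e / 2)))"
      by (simp only: l_def powr_powr powr_add mult_ac)
    also have "real n * (c - e) * t + real n * (\<phi> s - t * (c - e / 2)) = - (real n * (t * e / 2)) + real n * \<phi> s"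
      by (simp add: algebra_simps)
    also have "?v powr (s - t - 1) * a powr (- (real n * (t * e / 2)) + real n * \<phi> s)
        = ?v powr (s - t - 1) * a powr (- (real n * (t * e / 2))) * ?g"
      by (simp only: powr_add mult.assoc)
    also have "\<dots> \<le> 1 / 4 * ?g" by (rule mult_right_mono[OF elim(2)]) simp
    finally have lower: "l powr t * block_sum n (s - t) \<le> 1 / 4 * ?g" .
    have "?g / 2 \<le> r powr (s - 1) * sum (pmf (replicate_pmf n P)) (blocks n \<inter> E n)"
      using window(1) upper lower block_sum_ge[OF elim(3) s] unfolding E by linarith
    \<comment> \<open>Dividing by \<open>r powr (s - 1)\<close> turns tilted mass into probability
      under the i.i.d. distribution.\<close>
    then have "r powr (- (s - 1)) * (?g / 2)
        \<le> r powr (- (s - 1)) * (r powr (s - 1) * sum (pmf (replicate_pmf n P)) (blocks n \<inter> E n))"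
      by (rule mult_left_mono) simp
    moreover have "r powr (- (s - 1)) * (?g / 2) = 1 / 2 * a powr (real n * (\<phi> s - (s - 1) * (c + e)))"
    proof -
      have "r powr (- (s - 1)) * ?g = a powr (real n * (c + e) * (- (s - 1)) + real n * \<phi> s)"
        by (simp only: r_def powr_powr powr_add)
      also have "real n * (c + e) * (- (s - 1)) + real n * \<phi> s = real n * (\<phi> s - (s - 1) * (c + e))"
        by (simp add: algebra_simps)
      finally show ?thesis by simp
    qed
    moreover have "r powr (- (s - 1)) * (r powr (s - 1) * x) = x" for x
      using lr by (simp add: powr_add[symmetric] flip: mult.assoc)
    ultimately have mass: "1 / 2 * a powr (real n * (\<phi> s - (s - 1) * (c + e)))
        \<le> sum (pmf (replicate_pmf n P)) (blocks n \<inter> E n)" by (simp only:)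
    have "sum (pmf (U n)) (blocks n \<inter> E n) \<le> l powr (- s) * (?v powr (s - 1) * ?g)"
      using window(2) mult_left_mono[OF block_sum_le[OF elim(3) s], of "l powr (- s)"] unfolding E by simp
    also have "\<dots> = ?v powr (s - 1) * a powr (real n * (c - e) * (- s) + real n * \<phi> s)"
      by (simp only: l_def powr_powr powr_add mult_ac)
    also have "real n * (c - e) * (- s) + real n * \<phi> s = real n * (\<phi> s - s * (c - e))"
      by (simp add: algebra_simps)
    finally show ?case using mass by simp
  qed
qed

text \<open>The window indicator meets the error constraint up to a polynomial and an arbitrarily
  small exponential factor; a randomization by \<open>\<kappa>\<close> removes both.\<close>

lemma exponent_le:
  assumes s: "s \<in> S" and R: "R \<le> s * deriv \<phi> s - \<phi> s"
  shows "strong_converse_exponent a P \<Q> R \<le> ereal ((s - 1) * deriv \<phi> s - \<phi> s)"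
proof (rule ereal_le_epsilon2)
  fix d :: real assume d: "0 < d"
  define c where "c = deriv \<phi> s"
  have s': "1 < s" using s by simp
  \<comment> \<open>The rate losses are \<open>(s - 1) * e\<close> from the window,
    \<open>(s + 1) * e\<close> from \<open>\<kappa>\<close> and \<open>e\<close> from the factor
    1/2; they add up to \<open>d\<close>.\<close>
  define e where "e = d / (2 * s + 1)"
  have e: "0 < e" "d = (2 * s + 1) * e" using d s' by (auto simp: e_def)
  define I where "I = (s - 1) * c - \<phi> s"
  have "\<forall>\<^sub>F n in sequentially. poly v (real n) powr s * a powr (- (real n * e)) \<le> 1"
    by (rule eventually_v_le) (use e s' in auto)
  \<comment> \<open>As \<open>poly v (real n) \<ge> 1\<close>, this also makes
    \<open>a powr (- (real n * e))\<close> at most 1/2, which pays for the factor 1/2 in the mass of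
    the window.\<close>
  moreover have "\<forall>\<^sub>F n in sequentially. poly v (real n) powr 1 * a powr (- (real n * e)) \<le> 1 / 2"
    by (rule eventually_v_le) (use e in auto)
  ultimately have "\<forall>\<^sub>F n in sequentially. exponent_seq R n \<le> I + d"
    using tilted_test[OF s e(1), folded c_def] eventually_ge_at_top[of 1]
  proof eventually_elim
    case (elim n)
    let ?v = "poly v (real n)"
    define E where "E = {xs. a powr (real n * (c - e)) * pmf (U n) xs \<le> pmf (replicate_pmf n P) xs \<and>
      pmf (replicate_pmf n P) xs \<le> a powr (real n * (c + e)) * pmf (U n) xs}"
    \<comment> \<open>Of the exponent, \<open>s * e\<close> compensates the lower edge of the window
      and the further \<open>e\<close> absorbs \<open>poly v (real n) powr s\<close>.\<close>
    define \<kappa> where "\<kappa> = a powr (- (real n * ((s + 1) * e)))"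
    define T where "T = (\<lambda>xs. \<kappa> * indicator E xs :: real)"
    have \<kappa>: "0 < \<kappa>" "\<kappa> \<le> 1" using base e s' powr_mono[of "- (real n * ((s + 1) * e))" 0 a] by (auto simp: \<kappa>_def)
    have test_sum: "(\<Sum>xs\<in>blocks n. f xs * T xs) = \<kappa> * sum f (blocks n \<inter> E)" for f
      unfolding sum.inter_restrict[OF finite_blocks] sum_distrib_left
      by (rule sum.cong) (auto simp: T_def indicator_def)
    have v1: "1 \<le> ?v" by (rule poly_v_ge_1[OF elim(4)])
    show ?case
    proof (rule exponent_seq_le[OF elim(4)])
      show "T \<in> blocks n \<rightarrow> {0..1}" using \<kappa> by (auto simp: T_def indicator_def)
    next
      fix Q assume Q: "Q \<in> \<Q> n"
      obtain Q' where Q': "Q' \<in> \<Q> n \<inter> sym_dists n"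
          "\<And>xs. xs \<in> blocks n \<Longrightarrow> pmf Q' xs = 1 / fact n * (\<Sum>\<pi> | \<pi> permutes {..<n}. pmf Q (permute_list \<pi> xs))"
        using symmetrization[OF elim(4) Q] by blast
      \<comment> \<open>The window compares two symmetric distributions, so it is invariant.\<close>
      have sym: "T (permute_list \<pi> xs) = T xs" if "\<pi> permutes {..<n}" "xs \<in> blocks n" for \<pi> xs
        using that U_sym[OF elim(4)] replicate_pmf_in_sym_dists[of n P]
        by (simp add: T_def E_def indicator_def sym_dists_def)
      have "(\<Sum>xs\<in>blocks n. pmf Q xs * T xs) = (\<Sum>xs\<in>blocks n. pmf Q' xs * T xs)"
        by (rule sum_symmetrized_test[OF Q'(2) sym, symmetric])
      also have "\<dots> \<le> (\<Sum>xs\<in>blocks n. ?v * pmf (U n) xs * T xs)"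
        by (intro sum_mono mult_right_mono U_dominates[OF elim(4) Q'(1)]) (use \<kappa> in \<open>auto simp: T_def\<close>)
      also have "\<dots> = \<kappa> * (?v * sum (pmf (U n)) (blocks n \<inter> E))"
        unfolding test_sum by (simp add: sum_distrib_left)
      also have "\<dots> \<le> \<kappa> * (?v * (?v powr (s - 1) * a powr (real n * (\<phi> s - s * (c - e)))))"
        by (intro mult_left_mono) (use elim(3) \<kappa> v1 in \<open>auto simp: E_def\<close>)
      also have "\<dots> = ?v powr (1 + (s - 1)) * a powr (- (real n * ((s + 1) * e)) + real n * (\<phi> s - s * (c - e)))"
        unfolding \<kappa>_def powr_add using v1 by (simp add: mult_ac)
      also have "1 + (s - 1) = s" by simp
      also have "- (real n * ((s + 1) * e)) + real n * (\<phi> s - s * (c - e))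
          = - (real n * e) + - (real n * (s * c - \<phi> s))" by (simp add: algebra_simps)
      also have "?v powr s * a powr (- (real n * e) + - (real n * (s * c - \<phi> s)))
          = ?v powr s * a powr (- (real n * e)) * a powr (- (real n * (s * c - \<phi> s)))"
        by (simp only: powr_add mult.assoc)
      also have "\<dots> \<le> 1 * a powr (- (real n * R))"
        by (intro mult_mono) (use elim(1) base R in \<open>auto simp: c_def intro: mult_left_mono\<close>)
      finally show "(\<Sum>xs\<in>blocks n. pmf Q xs * T xs) \<le> a powr (- (real n * R))" by simp
    next
      have "a powr (- (real n * e)) \<le> 1 / 2"
        using elim(2) v1 mult_right_mono[OF v1, of "a powr (- (real n * e))"] by simp
      then have "\<kappa> * (a powr (- (real n * e)) * a powr (real n * (\<phi> s - (s - 1) * (c + e))))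
          \<le> \<kappa> * (1 / 2 * a powr (real n * (\<phi> s - (s - 1) * (c + e))))"
        using \<kappa> by (intro mult_left_mono mult_right_mono) auto
      also have "\<dots> \<le> \<kappa> * sum (pmf (replicate_pmf n P)) (blocks n \<inter> E)"
        by (intro mult_left_mono) (use elim(3) \<kappa> in \<open>auto simp: E_def\<close>)
      also have "\<kappa> * (a powr (- (real n * e)) * a powr (real n * (\<phi> s - (s - 1) * (c + e))))
          = a powr (- (real n * ((s + 1) * e)) + (- (real n * e) + real n * (\<phi> s - (s - 1) * (c + e))))"
        by (simp only: \<kappa>_def powr_add)
      also have "- (real n * ((s + 1) * e)) + (- (real n * e) + real n * (\<phi> s - (s - 1) * (c + e)))
          = - (real n * (I + d))" by (simp add: e(2) I_def algebra_simps)
      finally show "a powr (- (real n * (I + d))) \<le> (\<Sum>xs\<in>blocks n. pmf (replicate_pmf n P) xs * T xs)"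
        by (simp only: test_sum)
    qed
  qed
  then have "strong_converse_exponent a P \<Q> R \<le> ereal (I + d)"
    unfolding strong_converse_exponent_eq by (intro Limsup_bounded) auto
  then show "strong_converse_exponent a P \<Q> R \<le> ereal ((s - 1) * deriv \<phi> s - \<phi> s) + ereal d"
    by (simp add: I_def c_def)
qed

section \<open>Optimization over the order\<close>

abbreviation rate :: "real \<Rightarrow> real" where
  "rate s \<equiv> s * deriv \<phi> s - \<phi> s"

abbreviation objective :: "real \<Rightarrow> real \<Rightarrow> real" where
  "objective R s \<equiv> (s - 1) / s * R - \<phi> s / s"

text \<open>Geometrically, the rate at s is minus the value at 0 of the tangent to the potential at s.\<close>

lemma rate_mono:
  assumes s: "s \<in> S" and t: "t \<in> S" and le: "s \<le> t"
  shows "rate s \<le> rate t"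
proof (cases "s = t")
  case False
  then have st: "0 < t - s" using le by simp
  \<comment> \<open>Adding the tangent inequalities at both points shows that the derivative is
    monotone.\<close>
  have "deriv \<phi> s * (t - s) + deriv \<phi> t * (s - t) \<le> 0"
    using potential_above_tangent[OF s t] potential_above_tangent[OF t s] by linarith
  then have "(t - s) * deriv \<phi> s \<le> (t - s) * deriv \<phi> t" by (simp add: algebra_simps)
  then have "deriv \<phi> s \<le> deriv \<phi> t" using st by (simp only: mult_le_cancel_left_pos)
  then have "s * deriv \<phi> s \<le> s * deriv \<phi> t" using s by (intro mult_left_mono) auto
  moreover have "\<phi> t + deriv \<phi> t * (s - t) \<le> \<phi> s" by (rule potential_above_tangent[OF t s])
  ultimately show ?thesis by (simp add: algebra_simps)
qed simp

text \<open>\<open>critical_rate\<close> is a \<open>Lim\<close>, which is informative once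
  convergence is known. Monotonicity of the rate gives convergence to its supremum.\<close>

lemma exists_rate_above:
  assumes "ereal R < critical_rate a P (single_letter \<Q>) b"
  shows "\<exists>s\<in>S. R < rate s"
proof -
  define F where "F = (if b = \<infinity> then at_top else at_left (real_of_ereal b))"
  have ev: "\<forall>\<^sub>F s in F. s \<in> S \<and> s\<^sub>0 \<le> s" if s0: "s\<^sub>0 \<in> S" for s\<^sub>0
  proof (cases "b = \<infinity>")
    case True
    then have "\<forall>\<^sub>F s in F. s\<^sub>0 \<le> s" by (simp add: F_def)
    then show ?thesis by (rule eventually_mono) (use s0 True in auto)
  next
    case False
    then obtain r where r: "b = ereal r" using b by (cases b) auto
    then have "\<forall>\<^sub>F s in at_left r. s \<in> {s\<^sub>0<..<r}" using s0 by (intro eventually_at_left_real) auto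
    then show ?thesis using s0 unfolding F_def r by (auto elim: eventually_mono)
  qed
  have "((\<lambda>s. ereal (rate s)) \<longlongrightarrow> (SUP s\<in>S. ereal (rate s))) F"
  proof (rule increasing_tendsto)
    obtain s\<^sub>0 where "s\<^sub>0 \<in> S" using eventually_happens'[OF _ eventually_at_right_1_S] by auto
    then show "\<forall>\<^sub>F s in F. ereal (rate s) \<le> (SUP s\<in>S. ereal (rate s))"
      by (rule eventually_mono[OF ev]) (auto intro: SUP_upper)
  next
    fix x assume "x < (SUP s\<in>S. ereal (rate s))"
    then obtain s\<^sub>0 where s0: "s\<^sub>0 \<in> S" "x < ereal (rate s\<^sub>0)" unfolding less_SUP_iff by blast
    show "\<forall>\<^sub>F s in F. x < ereal (rate s)"
      using ev[OF s0(1)]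
    proof eventually_elim
      case (elim s)
      then have "ereal (rate s\<^sub>0) \<le> ereal (rate s)" using rate_mono[OF s0(1)] by simp
      then show ?case using s0(2) by (rule less_le_trans[rotated])
    qed
  qed
  moreover have "F \<noteq> bot" by (simp add: F_def trivial_limit_at_left_real)
  ultimately have "critical_rate a P (single_letter \<Q>) b = (SUP s\<in>S. ereal (rate s))"
    unfolding critical_rate_def F_def[symmetric] by (intro tendsto_Lim)
  then show ?thesis using assms by (auto simp: less_SUP_iff)
qed

section \<open>The objective on a compact interval of orders\<close>

lemma objective_has_derivative:
  assumes s: "s \<in> S"
  shows "(objective R has_real_derivative (R - rate s) / s ^ 2) (at s)"
proof -
  have "s \<noteq> 0" using s by auto
  then show ?thesis
    by (auto intro!: derivative_eq_intros potential_has_derivative[OF s] simp: power2_eq_square)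
      (simp add: divide_simps, simp add: algebra_simps)
qed

lemma objective_tendsto_0: "(objective R \<longlongrightarrow> 0) (at_right 1)"
proof -
  have "(objective R \<longlongrightarrow> (1 - 1) / 1 * R - 0 / 1) (at_right 1)"
    by (intro tendsto_intros potential_tendsto_0) auto
  then show ?thesis by simp
qed

text \<open>In \<open>ereal\<close> the factor 0 annihilates even an infinite divergence, so the
  potential at 1 is 0. This value agrees with the right limit and makes the objective continuous up
  to 1.\<close>

lemma objective_1: "objective R 1 = 0"
  by (simp add: renyi_potential_def flip: zero_ereal_def)

lemma continuous_on_objective:
  assumes s1: "s\<^sub>1 \<in> S"
  shows "continuous_on {1..s\<^sub>1} (objective R)"
  unfolding continuous_on_def
proof
  fix s assume s: "s \<in> {1..s\<^sub>1}"
  show "(objective R \<longlongrightarrow> objective R s) (at s within {1..s\<^sub>1})"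
  proof (cases "s = 1")
    case True
    then show ?thesis
      using s1 objective_tendsto_0[of R] objective_1[of R] at_within_Icc_at_right[of 1 s\<^sub>1] by simp
  next
    case False
    then have "s \<in> S" using s s1 by (auto intro: le_less_trans[of "ereal s" "ereal s\<^sub>1"])
    from DERIV_isCont[OF objective_has_derivative[OF this]] show ?thesis
      unfolding isCont_def by (rule tendsto_within_subset) simp
  qed
qed

text \<open>As \<open>s\<close> tends to 1, the achievable exponent is controlled by the potential
  itself: the tangent at \<open>s\<close>, evaluated at \<open>u\<close>, bounds the term
  \<open>(s - 1) * deriv \<phi> s\<close>.\<close>

lemma strong_converse_exponent_le_0:
  assumes s1: "s\<^sub>1 \<in> S" and rate: "\<And>s. 1 < s \<Longrightarrow> s < s\<^sub>1 \<Longrightarrow> R \<le> rate s"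
  shows "strong_converse_exponent a P \<Q> R \<le> 0"
proof (rule ereal_le_epsilon2)
  fix d :: real assume d: "0 < d"
  have "\<forall>\<^sub>F u in at_right 1. \<phi> u < d" using potential_tendsto_0 d by (rule order_tendstoD)
  moreover have "\<forall>\<^sub>F u in at_right 1. u \<in> {1<..<s\<^sub>1}" using s1 by (intro eventually_at_right_real) auto
  ultimately have "\<forall>\<^sub>F u in at_right 1. \<phi> u < d \<and> u \<in> {1<..<s\<^sub>1}" by eventually_elim simp
  then obtain u where u: "\<phi> u < d" "1 < u" "u < s\<^sub>1"
    using eventually_happens'[of "at_right (1::real)"] by auto
  \<comment> \<open>The midpoint of 1 and \<open>u\<close>, so that the tangent increment
    \<open>u - s\<close> equals \<open>s - 1\<close>.\<close>
  define s where "s = (1 + u) / 2"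
  have in_S: "t \<in> S" if "1 < t" "t < s\<^sub>1" for t
    using that s1 by (auto intro: less_trans[of "ereal t" "ereal s\<^sub>1"])
  have s: "1 < s" "s < s\<^sub>1" "u - s = s - 1" using u by (auto simp: s_def field_simps)
  note S = in_S[OF s(1,2)] in_S[OF u(2,3)]
  have "strong_converse_exponent a P \<Q> R \<le> ereal ((s - 1) * deriv \<phi> s - \<phi> s)"
    by (rule exponent_le[OF S(1) rate[OF s(1,2)]])
  also have "(s - 1) * deriv \<phi> s - \<phi> s \<le> d"
  proof -
    have "\<phi> s + deriv \<phi> s * (s - 1) \<le> \<phi> u" using potential_above_tangent[OF S] by (simp only: s(3))
    moreover have "0 \<le> \<phi> s" by (rule potential_nonneg[OF S(1)])
    moreover have "deriv \<phi> s * (s - 1) = (s - 1) * deriv \<phi> s" by simp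
    ultimately show ?thesis using u(1) by linarith
  qed
  finally show "strong_converse_exponent a P \<Q> R \<le> 0 + ereal d" by simp
qed

lemma objective_eq:
  assumes s: "s \<in> S"
  shows "ereal ((s - 1) / s) * (ereal R - renyi_div_set a s P (single_letter \<Q>)) = ereal (objective R s)"
proof -
  obtain Q where div: "renyi_div_set a s P (single_letter \<Q>) = ereal (\<phi> s / (s - 1))"
    using minimizer[OF s] by blast
  have "s - 1 \<noteq> 0" "s \<noteq> 0" using s by auto
  then have "(s - 1) / s * (R - \<phi> s / (s - 1)) = objective R s"
    by (simp add: divide_simps)
  then show ?thesis by (simp add: div)
qed

theorem strong_converse_exponent_eq_SUP:
  assumes R: "0 < R" "ereal R < critical_rate a P (single_letter \<Q>) b"
  shows "strong_converse_exponent a P \<Q> R =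
    (SUP s\<in>S. ereal ((s - 1) / s) * (ereal R - renyi_div_set a s P (single_letter \<Q>)))"
proof -
  have "strong_converse_exponent a P \<Q> R = (SUP s\<in>S. ereal (objective R s))" (is "?sc = ?sup")
  proof (rule antisym)
    show "?sup \<le> ?sc"
    proof (rule SUP_least)
      fix s assume s: "s \<in> S"
      have "\<forall>\<^sub>F n in sequentially. ereal (objective R s) \<le> ereal (exponent_seq R n)"
        using eventually_ge_at_top[of 1] by eventually_elim (use exponent_seq_ge[OF _ s R(1)] in auto)
      then show "ereal (objective R s) \<le> ?sc"
        unfolding strong_converse_exponent_eq by (intro le_Limsup) auto
    qed
    \<comment> \<open>At such an order the objective is decreasing, so the maximization can be
      confined to \<open>{1..s\<^sub>1}\<close>.\<close>
    obtain s\<^sub>1 where s1: "s\<^sub>1 \<in> S" "R < rate s\<^sub>1" using exists_rate_above[OF R(2)] by blast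
    have in_S: "t \<in> S" if "1 < t" "t \<le> s\<^sub>1" for t
      using that s1(1) by (auto intro: le_less_trans[of "ereal t" "ereal s\<^sub>1"])
    have "{1..s\<^sub>1} \<noteq> {}" using s1(1) by auto
    then obtain s\<^sub>0 where s0: "s\<^sub>0 \<in> {1..s\<^sub>1}" and max: "\<And>s. s \<in> {1..s\<^sub>1} \<Longrightarrow> objective R s \<le> objective R s\<^sub>0"
      using continuous_attains_sup[OF compact_Icc _ continuous_on_objective[OF s1(1), of R]] by blast
    show "?sc \<le> ?sup"
    proof (cases "s\<^sub>0 = 1")
      case True
      \<comment> \<open>If \<open>rate s < R\<close>, monotonicity keeps the rate below
        \<open>R\<close> on (1, s), and the mean value theorem makes the objective at
        \<open>s\<close> exceed its maximum at 1.\<close>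
      have "R \<le> rate s" if s: "1 < s" "s < s\<^sub>1" for s
      proof (rule ccontr)
        assume not: "\<not> R \<le> rate s"
        have "continuous_on {1..s} (objective R)"
          by (rule continuous_on_subset[OF continuous_on_objective[OF s1(1)]]) (use s in auto)
        moreover have "objective R differentiable (at x)" if "1 < x" "x < s" for x
          using objective_has_derivative[OF in_S] that s unfolding real_differentiable_def
          by (meson less_imp_le less_trans)
        ultimately obtain l z where z: "1 < z" "z < s" "(objective R has_real_derivative l) (at z)"
            "objective R s - objective R 1 = (s - 1) * l"
          using MVT[OF s(1), of "objective R"] by blast
        have "z \<in> S" "s \<in> S" using in_S z s by auto
        then have "l = (R - rate z) / z ^ 2" "rate z \<le> rate s"
          using DERIV_unique[OF z(3) objective_has_derivative] rate_mono z(2) by auto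
        then have "0 < l" using not z(1) by simp
        then have "0 < (s - 1) * l" using s(1) by simp
        then show False using z(4) max[of s] s by (simp add: True)
      qed
      then have "?sc \<le> 0" by (rule strong_converse_exponent_le_0[OF s1(1)])
      \<comment> \<open>Order 1 lies outside \<open>S\<close>, so its value 0 enters as a limit of
        values in \<open>S\<close>.\<close>
      moreover have "ereal 0 \<le> ?sup"
      proof (rule tendsto_upperbound)
        show "((\<lambda>s. ereal (objective R s)) \<longlongrightarrow> ereal 0) (at_right 1)"
          by (intro tendsto_ereal objective_tendsto_0)
        show "\<forall>\<^sub>F s in at_right 1. ereal (objective R s) \<le> ?sup"
          using eventually_at_right_1_S by eventually_elim (rule SUP_upper)
      qed simp
      ultimately show ?thesis unfolding zero_ereal_def by (rule order_trans)
    next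
      case False
      then have S0: "s\<^sub>0 \<in> S" using s0 in_S by auto
      \<comment> \<open>The derivative at the right endpoint is negative, so points just to its left
        do better.\<close>
      have "s\<^sub>0 \<noteq> s\<^sub>1"
      proof
        assume eq: "s\<^sub>0 = s\<^sub>1"
        have "(R - rate s\<^sub>1) / s\<^sub>1 ^ 2 < 0" using s1 by (auto simp: divide_less_0_iff)
        then obtain d where d: "0 < d" "\<And>h. 0 < h \<Longrightarrow> h < d \<Longrightarrow> objective R s\<^sub>1 < objective R (s\<^sub>1 - h)"
          using DERIV_neg_dec_left[OF objective_has_derivative[OF s1(1)]] by blast
        define h where "h = min d (s\<^sub>1 - 1) / 2"
        have "0 < h" "h < d" "h < s\<^sub>1 - 1" using d(1) s1(1) by (auto simp: h_def min_def)
        then show False using d(2)[of h] max[of "s\<^sub>1 - h"] eq by auto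
      qed
      then have between: "1 < s\<^sub>0" "s\<^sub>0 < s\<^sub>1" using s0 False by auto
      have "(R - rate s\<^sub>0) / s\<^sub>0 ^ 2 = 0"
      proof (rule DERIV_local_max[OF objective_has_derivative[OF S0]])
        show "0 < min (s\<^sub>0 - 1) (s\<^sub>1 - s\<^sub>0)" using between by simp
        show "\<forall>y. \<bar>s\<^sub>0 - y\<bar> < min (s\<^sub>0 - 1) (s\<^sub>1 - s\<^sub>0) \<longrightarrow> objective R y \<le> objective R s\<^sub>0"
        proof (intro allI impI)
          fix y assume "\<bar>s\<^sub>0 - y\<bar> < min (s\<^sub>0 - 1) (s\<^sub>1 - s\<^sub>0)"
          then show "objective R y \<le> objective R s\<^sub>0" by (intro max) auto
        qed
      qed
      then have rate: "R = rate s\<^sub>0" using between by simp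
      have "?sc \<le> ereal ((s\<^sub>0 - 1) * deriv \<phi> s\<^sub>0 - \<phi> s\<^sub>0)"
        by (rule exponent_le[OF S0]) (use rate in simp)
      also have "(s\<^sub>0 - 1) * deriv \<phi> s\<^sub>0 - \<phi> s\<^sub>0 = objective R s\<^sub>0"
      proof -
        have "s\<^sub>0 \<noteq> 0" using between by simp
        then show ?thesis unfolding rate by (simp add: field_simps)
      qed
      also have "ereal (objective R s\<^sub>0) \<le> ?sup" by (rule SUP_upper[OF S0])
      finally show ?thesis .
    qed
  qed
  also have "\<dots> = (SUP s\<in>S. ereal ((s - 1) / s) * (ereal R - renyi_div_set a s P (single_letter \<Q>)))"
    by (rule SUP_cong[OF refl]) (simp only: objective_eq)
  finally show ?thesis .
qed

end

section \<open>From the axioms to the dominated setting\<close>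

theorem theorem10:
  fixes a :: real
    and P :: "'x::finite pmf"
    and \<Q> :: "nat \<Rightarrow> 'x list pmf set"
    and b :: ereal
    and J :: "real set"
    and \<Theta> :: "'v::euclidean_space set"
    and q :: "'v \<Rightarrow> 'x pmf"
    and R :: real
  assumes "a > 1"
    and "\<And>n. n \<ge> 1 \<Longrightarrow> \<Q> n \<subseteq> block_dists n"
    and "1 < b"
    and "J = {s. 1 \<le> s \<and> ereal s < b}"
    and "iid_closed \<Q>"
    and "renyi_superadditive a J P \<Q>"
    and "universally_dominated a J P \<Q>"
    and "regularly_parametrized a J P (single_letter \<Q>) \<Theta> q"
    and "R > 0"
    and "ereal R < critical_rate a P (single_letter \<Q>) b"
  shows "strong_converse_exponent a P \<Q> R =
    (SUP s\<in>{s. 1 < s \<and> ereal s < b}.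
       ereal ((s - 1) / s) * (ereal R - renyi_div_set a s P (single_letter \<Q>)))"
proof -
  obtain U v where U: "\<And>n. 1 \<le> n \<Longrightarrow> U n \<in> sym_dists n"
      "\<And>n Q xs. 1 \<le> n \<Longrightarrow> Q \<in> \<Q> n \<inter> sym_dists n \<Longrightarrow> xs \<in> blocks n \<Longrightarrow>
        pmf Q xs \<le> poly v (real n) * pmf (U n) xs"
      "\<And>n s. 1 \<le> n \<Longrightarrow> s \<in> J \<Longrightarrow>
        renyi_div_set a s (replicate_pmf n P) (\<Q> n) \<le> renyi_div a s (replicate_pmf n P) (U n)"
      "\<And>n Q. 1 \<le> n \<Longrightarrow> Q \<in> \<Q> n \<Longrightarrow> \<exists>Q'\<in>\<Q> n \<inter> sym_dists n. \<forall>xs\<in>blocks n.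
        pmf Q' xs = 1 / fact n * (\<Sum>\<pi> | \<pi> permutes {..<n}. pmf Q (permute_list \<pi> xs))"
    using assms(7) unfolding universally_dominated_def by blast
  have attained: "\<exists>Q\<in>single_letter \<Q>. renyi_sum s P Q \<noteq> \<infinity> \<and>
      (\<forall>Q'\<in>single_letter \<Q>. renyi_div a s P Q \<le> renyi_div a s P Q')" if s: "1 < s" "ereal s < b" for s
  proof -
    have "s \<in> J" using s assms(4) by simp
    then obtain \<theta> where \<theta>: "\<theta> \<in> rel_interior \<Theta>"
        "is_arg_min (\<lambda>\<theta>. renyi_div a s P (q \<theta>)) (\<lambda>\<theta>. \<theta> \<in> \<Theta>) \<theta>"
        "pos_def_hessian (\<lambda>\<theta>. renyi_sum s P (q \<theta>)) \<theta> \<Theta>"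
      using assms(8) s(1) unfolding regularly_parametrized_def by blast
    have image: "single_letter \<Q> = q ` \<Theta>"
      using assms(8) by (simp add: regularly_parametrized_def)
    have in\<Theta>: "\<theta> \<in> \<Theta>" using \<theta>(1) rel_interior_subset by blast
    \<comment> \<open>A Hessian within \<open>\<Theta>\<close> includes real values near the
      minimizer, in particular at the minimizer itself.\<close>
    obtain \<epsilon> f where "0 < \<epsilon>" "\<And>y. y \<in> \<Theta> \<inter> ball \<theta> \<epsilon> \<Longrightarrow> renyi_sum s P (q y) = ereal (f y)"
      using \<theta>(3) unfolding pos_def_hessian_def has_hessian_within_def by blast
    then have "renyi_sum s P (q \<theta>) \<noteq> \<infinity>" using in\<Theta> by simp
    then show ?thesis using \<theta>(2) in\<Theta> by (auto simp: image is_arg_min_linorder)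
  qed
  interpret dominated_alternatives a P \<Q> b U v
  proof
    show "renyi_superadditive a {s. 1 < s \<and> ereal s < b} P \<Q>"
      using assms(4,6) by (auto simp: renyi_superadditive_def)
    show "renyi_div_set a s (replicate_pmf n P) (\<Q> n) \<le> renyi_div a s (replicate_pmf n P) (U n)"
      if "1 \<le> n" "1 < s" "ereal s < b" for n s
      using U(3)[OF that(1)] that assms(4) by simp
  qed (fact assms(1,2,3,5) U(1,4) attained | rule U(2); assumption)+
  show ?thesis using strong_converse_exponent_eq_SUP[OF assms(9,10)] .
qed

end
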